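(* Let $c\ge 1$, $s\ge 0$, $-1\le\alpha\le 1$, and let $(y(t),\dot y(t))$ be the exact solution of the semidiscrete system $\ddot y=-\Omega^2y+f(y)$, satisfying $$\|y(t)\|_{s+1}+\|\dot y(t)\|_{s}\le M\qquad\text{for } 0\le t-t_0\le T .$$ Assume that Condition $A(\beta)$ holds with constant $c$ for $\beta=0$ and for $\beta=\alpha$. Let $(y^n,\dot y^n)$ be the numerical solution produced by the ERKN integrator with step size $h$ and starting values $y^0=y(t_0)$, $\dot y^0=\dot y(t_0)$. Then there exists $h_0>0$ such that for $0<h\le h_0$ $$\|y(t_n)-y^n\|_{s+1-\alpha}+\|\dot y(t_n)-\dot y^n\|_{s-\alpha}\le C h^{1+\alpha}\qquad\text{for } 0\le t_n-t_0=nh\le T,$$ where the constants $C$ and $h_0$ depend only on $M$, $s$, $p$, $T$ and $c$.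
   Context: **Semidiscrete system.** Let $p$ be a positive integer (the power in the wave equation $u_{tt}=u_{xx}+u^p$ with $2\pi$-periodic boundary conditions), $K\ge1$ an integer and $\mathcal K=\{-K,-K+1,\dots,K-1\}$. For $y(t)\in\mathbb C^{\mathcal K}$ consider $\ddot y(t)=-\Omega^2y(t)+f(y(t))$, where $\Omega=\mathrm{diag}(\omega_j)_{j\in\mathcal K}$ with $\omega_j=|j|$, and $f(y)=y*\cdots*y$ ($p$ factors) with the discrete convolution $(y*z)_j=\sum_{k+l\equiv j \bmod 2K}y_kz_l$ ($k,l,j\in\mathcal K$). **Norm.** For $\sigma\in\mathbb R$ and $y\in\mathbb C^{\mathcal K}$, $\|y\|_\sigma=\big(\sum_{j\in\mathcal K}\langle j\rangle^{2\sigma}|y_j|^2\big)^{1/2}$ with $\langle j\rangle=\max(1,|j|)$. **ERKN integrator.** Let $\mathrm{sinc}(x)=\sin(x)/x$, $\mathrm{sinc}(0)=1$, $h>0$ a step size, $V=h^2\Omega^2$, and let $\bar b_1,b_1$ be given scalar functions on $[0,\infty)$, with $\bar b_1(V)=\mathrm{diag}(\bar b_1(h^2\omega_j^2))$, $b_1(V)=\mathrm{diag}(b_1(h^2\omega_j^2))$. The one-stage explicit ERKN integrator (with $c_1=\tfrac12$) is $$y^{n+\frac12}=\cos(\tfrac12h\Omega)y^n+\tfrac12h\,\mathrm{sinc}(\tfrac12h\Omega)\dot y^n,$$ $$y^{n+1}=\cos(h\Omega)y^n+h\,\mathrm{sinc}(h\Omega)\dot y^n+h^2\bar b_1(V)f(y^{n+\frac12}),$$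 $$\dot y^{n+1}=-\Omega\sin(h\Omega)y^n+\cos(h\Omega)\dot y^n+h\,b_1(V)f(y^{n+\frac12}).$$ Write $t_n=t_0+nh$. **Condition $A(\beta)$ with constant $c$** (for $-1\le\beta\le1$): for all $\xi=h\omega_j$ with $j\in\mathcal K$, $\omega_j\ne0$, $|\bar b_1(\xi^2)|\le c\,\xi^\beta$ if $-1\le\beta\le0$; $\ |\tfrac12\mathrm{sinc}^2(\xi/2)-\bar b_1(\xi^2)|\le c\,\xi^\beta$ if $0<\beta\le1$; and $|1-b_1(\xi^2)|\le c\,\xi^{1+\beta}$ in all cases.
   Formalization: Condition A says nothing at frequency zero, where the claim can fail; the formal theorem also assumes its limit as ξ→0+: b_1(0)=1, |b̄_1(0)|≤c, and b̄_1(0)=1/2 if α>0 (automatic for coefficients continuous at 0 satisfying Condition A near 0). *)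

theory Defs
  imports "HOL-Analysis.Analysis" "HOL-Probability.Sinc_Integral" "HOL-Number_Theory.Cong"
begin

text \<open>
  The dimension $2K$ varies inside the theorem, so a vector in $\mathbb{C}^{\mathcal K}$ is a
  function \<open>int \<Rightarrow> complex\<close> of which only the entries with index in \<open>idx K\<close> are ever used.
\<close>

definition idx :: "int \<Rightarrow> int set" where
  "idx K = {-K..<K}"

definition omega :: "int \<Rightarrow> real" where
  "omega j = real_of_int \<bar>j\<bar>"

definition dconv :: "int \<Rightarrow> (int \<Rightarrow> complex) \<Rightarrow> (int \<Rightarrow> complex) \<Rightarrow> (int \<Rightarrow> complex)" where
  "dconv K y z = (\<lambda>j. \<Sum>(k, l) \<in> {(k, l). k \<in> idx K \<and> l \<in> idx K \<and> [k + l = j] (mod (2 * K))}. y k * z l)"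

text \<open>The product $y * \cdots * y$ with $p$ factors; only meaningful for \<open>p \<ge> 1\<close>.\<close>

definition nonlin :: "int \<Rightarrow> nat \<Rightarrow> (int \<Rightarrow> complex) \<Rightarrow> (int \<Rightarrow> complex)" where
  "nonlin K p y = ((dconv K y) ^^ (p - 1)) y"

definition jap :: "int \<Rightarrow> real" where
  "jap j = max 1 (real_of_int \<bar>j\<bar>)"

definition snorm :: "int \<Rightarrow> real \<Rightarrow> (int \<Rightarrow> complex) \<Rightarrow> real" where
  "snorm K \<sigma> y = sqrt (\<Sum>j\<in>idx K. jap j powr (2 * \<sigma>) * (cmod (y j))\<^sup>2)"

definition semidiscrete_solution ::
  "int \<Rightarrow> nat \<Rightarrow> real set \<Rightarrow> (real \<Rightarrow> int \<Rightarrow> complex) \<Rightarrow> (real \<Rightarrow> int \<Rightarrow> complex) \<Rightarrow> bool" where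
  "semidiscrete_solution K p I y y' \<longleftrightarrow>
     (\<forall>t\<in>I. \<forall>j\<in>idx K.
        ((\<lambda>\<tau>. y \<tau> j) has_vector_derivative y' t j) (at t within I) \<and>
        ((\<lambda>\<tau>. y' \<tau> j) has_vector_derivative
            (- ((omega j)\<^sup>2 *\<^sub>R y t j) + nonlin K p (y t) j)) (at t within I))"

definition erkn_mid :: "real \<Rightarrow> (int \<Rightarrow> complex) \<Rightarrow> (int \<Rightarrow> complex) \<Rightarrow> (int \<Rightarrow> complex)" where
  "erkn_mid h y y' = (\<lambda>j.
     cos (h * omega j / 2) *\<^sub>R y j + (h / 2 * sinc (h * omega j / 2)) *\<^sub>R y' j)"

definition erkn_step ::
  "int \<Rightarrow> nat \<Rightarrow> real \<Rightarrow> (real \<Rightarrow> real) \<Rightarrow> (real \<Rightarrow> real) \<Rightarrow>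
   (int \<Rightarrow> complex) \<times> (int \<Rightarrow> complex) \<Rightarrow> (int \<Rightarrow> complex) \<times> (int \<Rightarrow> complex)" where
  "erkn_step K p h bb b = (\<lambda>(y, y').
     ((\<lambda>j. cos (h * omega j) *\<^sub>R y j + (h * sinc (h * omega j)) *\<^sub>R y' j
           + (h\<^sup>2 * bb (h\<^sup>2 * (omega j)\<^sup>2)) *\<^sub>R nonlin K p (erkn_mid h y y') j),
      (\<lambda>j. - ((omega j * sin (h * omega j)) *\<^sub>R y j) + cos (h * omega j) *\<^sub>R y' j
           + (h * b (h\<^sup>2 * (omega j)\<^sup>2)) *\<^sub>R nonlin K p (erkn_mid h y y') j)))"

definition erkn ::
  "int \<Rightarrow> nat \<Rightarrow> real \<Rightarrow> (real \<Rightarrow> real) \<Rightarrow> (real \<Rightarrow> real) \<Rightarrow>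
   (int \<Rightarrow> complex) \<times> (int \<Rightarrow> complex) \<Rightarrow> nat \<Rightarrow> (int \<Rightarrow> complex) \<times> (int \<Rightarrow> complex)" where
  "erkn K p h bb b y0 n = ((erkn_step K p h bb b) ^^ n) y0"

text \<open>Throughout, \<open>bb\<close> stands for $\bar b_1$ and \<open>b\<close> for $b_1$.\<close>

definition condA :: "int \<Rightarrow> real \<Rightarrow> (real \<Rightarrow> real) \<Rightarrow> (real \<Rightarrow> real) \<Rightarrow> real \<Rightarrow> real \<Rightarrow> bool" where
  "condA K h bb b c \<beta> \<longleftrightarrow>
     (\<forall>j\<in>idx K. omega j \<noteq> 0 \<longrightarrow>
        (let \<xi> = h * omega j in
          (-1 \<le> \<beta> \<and> \<beta> \<le> 0 \<longrightarrow> \<bar>bb (\<xi>\<^sup>2)\<bar> \<le> c * \<xi> powr \<beta>) \<and>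
          (0 < \<beta> \<and> \<beta> \<le> 1 \<longrightarrow> \<bar>(sinc (\<xi> / 2))\<^sup>2 / 2 - bb (\<xi>\<^sup>2)\<bar> \<le> c * \<xi> powr \<beta>) \<and>
          \<bar>1 - b (\<xi>\<^sup>2)\<bar> \<le> c * \<xi> powr (1 + \<beta>)))"

text \<open>
  \<open>condA\<close> says nothing about the coefficient values at $\xi = 0$, which act on the
  zero-frequency component.  There the integrator reduces to a Runge-Kutta-Nystrom method with
  weights \<open>bb 0\<close> and \<open>b 0\<close>, which does not converge unless \<open>b 0 = 1\<close>; the coefficient functions
  of an ERKN integrator are understood to be continuous at 0.  \<open>condA_zero\<close> is the limit of the
  inequalities in \<open>condA\<close> for $\xi \to 0+$: the right-hand side $c\,\xi^\gamma$ tends to $\infty$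
  if $\gamma < 0$, to $c$ if $\gamma = 0$, and to $0$ if $\gamma > 0$.
\<close>

definition condA_zero :: "(real \<Rightarrow> real) \<Rightarrow> (real \<Rightarrow> real) \<Rightarrow> real \<Rightarrow> real \<Rightarrow> bool" where
  "condA_zero bb b c \<beta> \<longleftrightarrow>
     (\<beta> = 0 \<longrightarrow> \<bar>bb 0\<bar> \<le> c) \<and>
     (0 < \<beta> \<longrightarrow> bb 0 = 1 / 2) \<and>
     (\<beta> = -1 \<longrightarrow> \<bar>1 - b 0\<bar> \<le> c) \<and>
     (-1 < \<beta> \<longrightarrow> b 0 = 1)"

end

theory Submission
  imports Defs
begin

text \<open>
The proof is the classical combination of stability and local errors, carried out in a scale of Sobolev
norms with constants that do not depend on the dimension \<open>2 * K\<close>.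

Three facts make the uniformity possible.  First, products of trigonometric polynomials obey the
Sobolev product estimates uniformly in \<open>K\<close> although indices are taken modulo \<open>2 * K\<close>
(\<open>snorm_dconv_le\<close>).  Hence \<open>f\<close> is Lipschitz in all norms of order between \<open>s - 1\<close> and \<open>s + 1\<close> on balls of
the space of order \<open>s + 1\<close>, and \<open>t \<mapsto> f(y(t))\<close> is bounded in order \<open>s + 1\<close>, Lipschitz in order \<open>s\<close>, and
has second differences of size \<open>O(h\<^sup>2)\<close> in order \<open>s - 1\<close>.  Each time derivative costs one space derivative.

Second, the method is exact for the linear part, so that by variation of constants the local error
contains only the quadrature error for \<open>f(y(t))\<close> and the defects of the weights.  Each
additional derivative in the norm costs one power of \<open>h\<close> in the quadrature error; interpolation
between two such norms (\<open>snorm_interpolation\<close>) and Condition \<open>A(\<alpha>)\<close> give \<open>O(h powr (2 + \<alpha>))\<close> in the norms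
of order \<open>s + 1 - \<alpha>\<close> for the position and \<open>s - \<alpha>\<close> for the velocity (\<open>local_error_pos\<close>,
\<open>local_error_vel\<close>).

Third, the linear flow is an isometry of the energy norm up to a factor \<open>1 + h\<close>, and the nonlinear part of
a step is \<open>O(h)\<close>-Lipschitz in it as long as the internal stages stay in a ball of order \<open>s + 1\<close>
(\<open>erkn_step_stable\<close>).  The discrete Gronwall inequality thus gives first order for \<open>\<alpha> = 0\<close>.  For small
\<open>h\<close> this confines the numerical solution to such a ball, after which the same recursion can be summed
for the given \<open>\<alpha>\<close> (\<open>global_error\<close>).
\<close>

section \<open>Frequency weights on the cyclic group\<close>

lemma jap_ge_1: "1 \<le> jap j"
  by (simp add: jap_def)

lemma jap_pos: "0 < jap j"
  using jap_ge_1[of j] by linarith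

lemma omega_nonneg: "0 \<le> omega j"
  by (simp add: omega_def)

lemma omega_le_jap: "omega j \<le> jap j"
  by (simp add: omega_def jap_def)

lemma jap_eq_omega: "omega j \<noteq> 0 \<Longrightarrow> jap j = omega j"
  by (auto simp: omega_def jap_def)

lemma jap_eq_1: "omega j = 0 \<Longrightarrow> jap j = 1"
  by (auto simp: omega_def jap_def)

lemma finite_idx [simp]: "finite (idx K)"
  by (simp add: idx_def)

text \<open>
The set \<open>idx K\<close> is the window of residues of least absolute value modulo \<open>2 * K\<close>.  Together with
the ordinary triangle inequality this is why wrapping indices around costs nothing: the weights
\<open>jap\<close> obey the triangle inequality on the cyclic group.
\<close>

lemma abs_idx_le:
  assumes "j \<in> idx K" "[x = j] (mod (2 * K))"
  shows "\<bar>j\<bar> \<le> \<bar>x\<bar>"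
proof -
  from assms(2) obtain m where m: "x = j + 2 * K * m"
    by (metis cong_iff_lin cong_sym)
  have K: "-K \<le> j" "j < K" "0 < K"
    using assms(1) by (auto simp: idx_def)
  \<comment> \<open>Adding a nonzero multiple of the period to \<open>j\<close> leads at least as far from \<open>0\<close> as \<open>j\<close> is.\<close>
  consider "m = 0" | "1 \<le> m" | "m \<le> -1" by linarith
  then show ?thesis
  proof cases
    case 2
    then have "K * 1 \<le> K * m" using K by (intro mult_left_mono) auto
    then have "j + 2 * K \<le> x" using m by simp
    then show ?thesis using K by auto
  next
    case 3
    then have "K * m \<le> K * (-1)" using K by (intro mult_left_mono) auto
    then have "x \<le> j - 2 * K" using m by simp
    then show ?thesis using K by auto
  qed (use m in auto)
qed

lemma jap_triangle:
  assumes "k \<in> idx K" "l \<in> idx K" "j \<in> idx K" "[k + l = j] (mod (2 * K))"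
  shows "jap j \<le> jap k + jap l" "jap k \<le> jap j + jap l" "jap l \<le> jap j + jap k"
proof -
  have *: "jap a \<le> jap b + jap c" if "\<bar>a\<bar> \<le> \<bar>b\<bar> + \<bar>c\<bar>" for a b c
    using that unfolding jap_def by linarith
  have "\<bar>j\<bar> \<le> \<bar>k + l\<bar>" using assms by (intro abs_idx_le) auto
  then show "jap j \<le> jap k + jap l" by (intro *) auto
  have "[j - l = k] (mod (2 * K))"
    using assms(4) by (metis add_diff_cancel_right' cong_diff cong_refl cong_sym)
  then have "\<bar>k\<bar> \<le> \<bar>j - l\<bar>" using assms by (intro abs_idx_le) auto
  then show "jap k \<le> jap j + jap l" by (intro *) auto
  have "[j - k = l] (mod (2 * K))"
    using assms(4) by (metis add_diff_cancel_left' cong_diff cong_refl cong_sym)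
  then have "\<bar>l\<bar> \<le> \<bar>j - k\<bar>" using assms by (intro abs_idx_le) auto
  then show "jap l \<le> jap j + jap k" by (intro *) auto
qed

text \<open>
In a triangle the two longest sides are comparable, so the weight of the longest side can be
moved to the middle one; since \<open>0 \<le> b + c\<close>, the resulting power of the middle side can then be moved
down to the shortest side \<open>x\<close>, which ends up carrying the whole exponent \<open>a + b + c \<ge> 1\<close>.
\<close>

lemma triangle_weight_sorted:
  fixes x y z :: real
  assumes "1 \<le> x" "x \<le> y" "y \<le> z" "z \<le> 2 * y"
    and "0 \<le> b + c" "1 \<le> a + b + c" "\<bar>c\<bar> \<le> m"
  shows "x powr -a * y powr -b * z powr -c \<le> 2 powr m * (1 / x)"
proof -
  have "z powr -c \<le> 2 powr m * y powr -c"
  proof (cases "0 \<le> c")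
    case True
    then have "z powr -c \<le> y powr -c"
      using assms by (intro powr_mono2') auto
    also have "\<dots> \<le> 2 powr m * y powr -c"
      using assms by (simp add: mult_le_cancel_right1 ge_one_powr_ge_zero)
    finally show ?thesis .
  next
    case False
    then have "z powr -c \<le> (2 * y) powr -c"
      using assms by (intro powr_mono2) auto
    also have "\<dots> = 2 powr -c * y powr -c"
      using assms by (simp add: powr_mult)
    also have "\<dots> \<le> 2 powr m * y powr -c"
      using assms False by (intro mult_right_mono powr_mono) auto
    finally show ?thesis .
  qed
  then have "x powr -a * y powr -b * z powr -c \<le> x powr -a * y powr -b * (2 powr m * y powr -c)"
    by (intro mult_left_mono) auto
  also have "\<dots> = 2 powr m * (x powr -a * y powr -(b + c))"
    using assms by (simp add: powr_add powr_diff powr_minus field_simps)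
  also have "\<dots> \<le> 2 powr m * (x powr -a * x powr -(b + c))"
    using assms by (intro mult_left_mono powr_mono2') auto
  also have "\<dots> = 2 powr m * x powr -(a + b + c)"
    by (simp add: powr_add[symmetric] algebra_simps)
  also have "\<dots> \<le> 2 powr m * x powr -1"
    using assms by (intro mult_left_mono powr_mono) auto
  also have "x powr -1 = 1 / x"
    using assms by (simp add: powr_minus divide_inverse)
  finally show ?thesis .
qed

text \<open>
The trilinear weight estimate behind all product estimates below.  It is symmetric in the three
exponents, so that it covers products measured in negative-order norms as well, which would otherwise
be reached by duality.  Which side is shortest is unknown, hence the sum on the right.
\<close>

lemma triangle_weight:
  fixes x y z :: real
  assumes "1 \<le> x" "1 \<le> y" "1 \<le> z" "x \<le> y + z" "y \<le> x + z" "z \<le> x + y"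
    and "0 \<le> a + b" "0 \<le> b + c" "0 \<le> a + c" "1 \<le> a + b + c"
    and "\<bar>a\<bar> \<le> m" "\<bar>b\<bar> \<le> m" "\<bar>c\<bar> \<le> m"
  shows "x powr -a * y powr -b * z powr -c \<le> 2 powr m * (1 / x + 1 / y + 1 / z)"
proof -
  have pos: "0 < 1 / x" "0 < 1 / y" "0 < 1 / z" using assms by auto
  have weaken: "L \<le> 2 powr m * (1 / x + 1 / y + 1 / z)"
    if "L \<le> 2 powr m * r" "r \<in> {1 / x, 1 / y, 1 / z}" for L r
  proof -
    have "r \<le> 1 / x + 1 / y + 1 / z" using that(2) pos by auto
    then have "2 powr m * r \<le> 2 powr m * (1 / x + 1 / y + 1 / z)"
      by (intro mult_left_mono) auto
    then show ?thesis using that(1) by linarith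
  qed
  consider "x \<le> y" "y \<le> z" | "x \<le> z" "z \<le> y" | "y \<le> x" "x \<le> z"
    | "y \<le> z" "z \<le> x" | "z \<le> x" "x \<le> y" | "z \<le> y" "y \<le> x" by linarith
  then show ?thesis
  proof cases
    case 1
    show ?thesis
      by (rule weaken[OF triangle_weight_sorted]) (use assms 1 in auto)
  next
    case 2
    have "x powr -a * z powr -c * y powr -b \<le> 2 powr m * (1 / x)"
      by (rule triangle_weight_sorted) (use assms 2 in auto)
    then show ?thesis by (intro weaken[where r = "1 / x"]) (auto simp: mult_ac)
  next
    case 3
    have "y powr -b * x powr -a * z powr -c \<le> 2 powr m * (1 / y)"
      by (rule triangle_weight_sorted) (use assms 3 in auto)
    then show ?thesis by (intro weaken[where r = "1 / y"]) (auto simp: mult_ac)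
  next
    case 4
    have "y powr -b * z powr -c * x powr -a \<le> 2 powr m * (1 / y)"
      by (rule triangle_weight_sorted) (use assms 4 in auto)
    then show ?thesis by (intro weaken[where r = "1 / y"]) (auto simp: mult_ac)
  next
    case 5
    have "z powr -c * x powr -a * y powr -b \<le> 2 powr m * (1 / z)"
      by (rule triangle_weight_sorted) (use assms 5 in auto)
    then show ?thesis by (intro weaken[where r = "1 / z"]) (auto simp: mult_ac)
  next
    case 6
    have "z powr -c * y powr -b * x powr -a \<le> 2 powr m * (1 / z)"
      by (rule triangle_weight_sorted) (use assms 6 in auto)
    then show ?thesis by (intro weaken[where r = "1 / z"]) (auto simp: mult_ac)
  qed
qed

text \<open>
The correction \<open>4 / K\<close> makes the telescoping induction work.  What matters is uniformity in \<open>K\<close>: here the one-dimensionality of the wave equation enters, through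
\<open>\<Sum> \<langle>j\<rangle>\<^sup>-\<^sup>2 < \<infinity>\<close>.
\<close>

lemma sum_jap_inverse_squares:
  assumes "1 \<le> K"
  shows "(\<Sum>j\<in>idx K. (1 / jap j)\<^sup>2) \<le> 6 - 4 / real_of_int K"
  using assms
proof (induction K rule: int_ge_induct)
  case base
  have "idx 1 = {-1, 0}" by (auto simp: idx_def)
  then show ?case by (simp add: jap_def)
next
  case (step i)
  have split: "idx (i + 1) = insert i (insert (- i - 1) (idx i))"
    using step.hyps by (auto simp: idx_def)
  define r where "r = real_of_int i"
  have r: "1 \<le> r" using step.hyps by (simp add: r_def)
  have "(\<Sum>j\<in>idx (i + 1). (1 / jap j)\<^sup>2)
      = (1 / jap i)\<^sup>2 + ((1 / jap (- i - 1))\<^sup>2 + (\<Sum>j\<in>idx i. (1 / jap j)\<^sup>2))"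
    unfolding split using step.hyps by (subst sum.insert, simp, simp add: idx_def)+ simp
  also have "jap i = r" using step.hyps by (simp add: jap_def r_def)
  also have "jap (- i - 1) = r + 1" using step.hyps by (simp add: jap_def r_def)
  also have "(1 / r)\<^sup>2 + ((1 / (r + 1))\<^sup>2 + (\<Sum>j\<in>idx i. (1 / jap j)\<^sup>2))
      \<le> (1 / r)\<^sup>2 + ((1 / (r + 1))\<^sup>2 + (6 - 4 / r))"
    using step.IH by (simp add: r_def)
  also have "\<dots> \<le> 6 - 4 / (r + 1)"
  proof -
    have "(1 / r)\<^sup>2 = (1 / r) * (1 / r)" by (simp add: power2_eq_square)
    also have "\<dots> \<le> (1 / r) * (2 / (r + 1))"
      using r by (intro mult_left_mono) (auto simp: field_simps)
    finally have a: "(1 / r)\<^sup>2 \<le> (1 / r) * (2 / (r + 1))" .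
    have "(1 / (r + 1))\<^sup>2 \<le> (1 / r)\<^sup>2"
      using r by (intro power_mono) (auto simp: field_simps)
    then have "(1 / r)\<^sup>2 + (1 / (r + 1))\<^sup>2 \<le> 4 * (1 / r * (1 / (r + 1)))"
      using a by simp
    also have "1 / r * (1 / (r + 1)) = 1 / r - 1 / (r + 1)"
      using r by (simp add: field_simps)
    finally show ?thesis by simp
  qed
  finally show ?case by (simp add: r_def)
qed

lemma L2_set_jap_inverse: "1 \<le> K \<Longrightarrow> L2_set (\<lambda>j. 1 / jap j) (idx K) \<le> sqrt 6"
  using sum_jap_inverse_squares[of K] unfolding L2_set_def
  by (smt (verit) divide_nonneg_pos of_int_1_le_iff real_sqrt_le_iff)

section \<open>Discrete convolution\<close>

text \<open>
The representative in \<open>idx K\<close> of a residue class modulo \<open>2 * K\<close> (for \<open>K \<ge> 1\<close>).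
\<close>

definition red :: "int \<Rightarrow> int \<Rightarrow> int" where
  "red K x = (x + K) mod (2 * K) - K"

lemma red_mem: "1 \<le> K \<Longrightarrow> red K x \<in> idx K"
  using pos_mod_bound[of "2 * K" "x + K"] pos_mod_sign[of "2 * K" "x + K"]
  by (auto simp: red_def idx_def)

lemma red_cong: "[red K x = x] (mod (2 * K))"
  by (simp add: red_def cong_def mod_diff_left_eq)

lemma red_unique:
  assumes "l \<in> idx K" "[l = x] (mod (2 * K))"
  shows "l = red K x"
proof -
  have "(l + K) mod (2 * K) = (x + K) mod (2 * K)"
    using assms(2) by (metis cong_add cong_def cong_refl)
  moreover have "(l + K) mod (2 * K) = l + K"
    using assms(1) by (intro mod_pos_pos_trivial) (auto simp: idx_def)
  ultimately show ?thesis by (simp add: red_def)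
qed

lemma bij_red_diff:
  assumes "1 \<le> K"
  shows "bij_betw (\<lambda>j. red K (j - k)) (idx K) (idx K)"
proof (rule bij_betw_byWitness[where f' = "\<lambda>j. red K (j + k)"])
  have "a = red K (red K (a - k) + k)" if "a \<in> idx K" for a
  proof (rule red_unique[OF that])
    have "[red K (a - k) + k = a - k + k] (mod (2 * K))" by (intro cong_add red_cong) simp
    then show "[a = red K (a - k) + k] (mod (2 * K))" by (simp add: cong_sym)
  qed
  then show "\<forall>a\<in>idx K. red K (red K (a - k) + k) = a" by simp
  have "a = red K (red K (a + k) - k)" if "a \<in> idx K" for a
  proof (rule red_unique[OF that])
    have "[red K (a + k) - k = a + k - k] (mod (2 * K))" by (intro cong_diff red_cong) simp
    then show "[a = red K (a + k) - k] (mod (2 * K))" by (simp add: cong_sym)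
  qed
  then show "\<forall>a\<in>idx K. red K (red K (a + k) - k) = a" by simp
qed (use assms red_mem in auto)

lemma bij_red_reflect:
  assumes "1 \<le> K"
  shows "bij_betw (\<lambda>k. red K (j - k)) (idx K) (idx K)"
proof (rule bij_betw_byWitness[where f' = "\<lambda>k. red K (j - k)"])
  have "a = red K (j - red K (j - a))" if "a \<in> idx K" for a
  proof (rule red_unique[OF that])
    have "[j - red K (j - a) = j - (j - a)] (mod (2 * K))" by (intro cong_diff red_cong) simp
    then show "[a = j - red K (j - a)] (mod (2 * K))" by (simp add: cong_sym)
  qed
  then show "\<forall>a\<in>idx K. red K (j - red K (j - a)) = a"
    and "\<forall>a\<in>idx K. red K (j - red K (j - a)) = a" by simp_all
qed (use assms red_mem in auto)

lemma dconv_eq: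
  assumes "1 \<le> K"
  shows "dconv K u v j = (\<Sum>k\<in>idx K. u k * v (red K (j - k)))"
proof -
  have "{(k, l). k \<in> idx K \<and> l \<in> idx K \<and> [k + l = j] (mod (2 * K))}
      = (\<lambda>k. (k, red K (j - k))) ` idx K"
  proof (intro equalityI subsetI; clarsimp)
    fix k l assume "k \<in> idx K" "l \<in> idx K" "[k + l = j] (mod (2 * K))"
    moreover have "l = red K (j - k)"
    proof (rule red_unique)
      have "[k + l - k = j - k] (mod (2 * K))" by (intro cong_diff) (use calculation in auto)
      then show "[l = j - k] (mod (2 * K))" by simp
    qed fact
    ultimately show "(k, l) \<in> (\<lambda>k. (k, red K (j - k))) ` idx K" by auto
  next
    fix k assume "k \<in> idx K"
    have "[k + red K (j - k) = k + (j - k)] (mod (2 * K))" by (intro cong_add red_cong) simp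
    then show "red K (j - k) \<in> idx K \<and> [k + red K (j - k) = j] (mod (2 * K))"
      using red_mem assms by simp
  qed
  then show ?thesis
    unfolding dconv_def by (simp add: sum.reindex inj_on_def)
qed

definition rconv :: "int \<Rightarrow> (int \<Rightarrow> real) \<Rightarrow> (int \<Rightarrow> real) \<Rightarrow> int \<Rightarrow> real" where
  "rconv K u v j = (\<Sum>k\<in>idx K. u k * v (red K (j - k)))"

lemma rconv_commute:
  assumes "1 \<le> K"
  shows "rconv K u v j = rconv K v u j"
proof -
  have "(\<Sum>k\<in>idx K. v k * u (red K (j - k)))
      = (\<Sum>k\<in>idx K. v (red K (j - k)) * u (red K (j - red K (j - k))))"
    by (rule sum.reindex_bij_betw[OF bij_red_reflect[OF assms], symmetric])
  also have "\<dots> = (\<Sum>k\<in>idx K. v (red K (j - k)) * u k)"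
  proof (rule sum.cong[OF refl])
    fix k assume k: "k \<in> idx K"
    have "k = red K (j - red K (j - k))"
    proof (rule red_unique[OF k])
      have "[j - red K (j - k) = j - (j - k)] (mod (2 * K))" by (intro cong_diff red_cong) simp
      then show "[k = j - red K (j - k)] (mod (2 * K))" by (simp add: cong_sym)
    qed
    then show "v (red K (j - k)) * u (red K (j - red K (j - k))) = v (red K (j - k)) * u k"
      by simp
  qed
  finally show ?thesis by (simp add: rconv_def mult.commute)
qed

lemma L2_set_sum_le:
  "finite A \<Longrightarrow> L2_set (\<lambda>j. \<Sum>k\<in>A. f k j) S \<le> (\<Sum>k\<in>A. L2_set (f k) S)"
proof (induction A rule: finite_induct)
  case empty
  then show ?case by (simp add: L2_set_0')
next
  case (insert a A)
  have "L2_set (\<lambda>j. f a j + (\<Sum>k\<in>A. f k j)) S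
      \<le> L2_set (f a) S + L2_set (\<lambda>j. \<Sum>k\<in>A. f k j) S"
    by (rule L2_set_triangle_ineq)
  then show ?case using insert by simp
qed

lemma L2_set_red_diff:
  assumes "1 \<le> K"
  shows "L2_set (\<lambda>j. v (red K (j - k))) (idx K) = L2_set v (idx K)"
  unfolding L2_set_def
  using sum.reindex_bij_betw[OF bij_red_diff[OF assms, of k], of "\<lambda>j. (v j)\<^sup>2"] by simp

lemma L2_set_red_reflect:
  assumes "1 \<le> K"
  shows "L2_set (\<lambda>k. v (red K (j - k))) (idx K) = L2_set v (idx K)"
  unfolding L2_set_def
  using sum.reindex_bij_betw[OF bij_red_reflect[OF assms, of j], of "\<lambda>j. (v j)\<^sup>2"] by simp

lemma rconv_young:
  assumes "1 \<le> K" "\<And>k. 0 \<le> u k"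
  shows "L2_set (rconv K u v) (idx K) \<le> (\<Sum>k\<in>idx K. u k) * L2_set v (idx K)"
proof -
  have "L2_set (rconv K u v) (idx K) \<le> (\<Sum>k\<in>idx K. L2_set (\<lambda>j. u k * v (red K (j - k))) (idx K))"
    unfolding rconv_def by (rule L2_set_sum_le) simp
  also have "\<dots> = (\<Sum>k\<in>idx K. u k * L2_set v (idx K))"
    using assms by (simp add: L2_set_right_distrib[symmetric] L2_set_red_diff)
  finally show ?thesis by (simp add: sum_distrib_right)
qed

lemma sum_mult_le_L2_set:
  fixes u v :: "'a \<Rightarrow> real"
  shows "(\<Sum>i\<in>A. u i * v i) \<le> L2_set u A * L2_set v A"
proof -
  have "(\<Sum>i\<in>A. u i * v i) \<le> (\<Sum>i\<in>A. \<bar>u i\<bar> * \<bar>v i\<bar>)"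
    by (intro sum_mono) (metis abs_ge_self abs_mult)
  then show ?thesis using L2_set_mult_ineq[of u v A] by linarith
qed

text \<open>
A factor \<open>1 / jap k\<close> is square summable, so by the Cauchy-Schwarz inequality it turns an \<open>\<ell>\<^sup>2\<close> factor into
an \<open>\<ell>\<^sup>1\<close> factor, to which the inequality of Young applies.
\<close>

lemma rconv_weighted_young:
  assumes K: "1 \<le> K" and u: "\<And>k. 0 \<le> u k"
  shows "L2_set (rconv K (\<lambda>k. 1 / jap k * u k) v) (idx K)
    \<le> sqrt 6 * (L2_set u (idx K) * L2_set v (idx K))"
proof -
  have "(\<Sum>k\<in>idx K. 1 / jap k * u k) \<le> L2_set (\<lambda>k. 1 / jap k) (idx K) * L2_set u (idx K)"
    by (rule sum_mult_le_L2_set)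
  also have "\<dots> \<le> sqrt 6 * L2_set u (idx K)"
    by (intro mult_right_mono L2_set_jap_inverse K) simp
  finally have *: "(\<Sum>k\<in>idx K. 1 / jap k * u k) \<le> sqrt 6 * L2_set u (idx K)" .
  have "L2_set (rconv K (\<lambda>k. 1 / jap k * u k) v) (idx K)
      \<le> (\<Sum>k\<in>idx K. 1 / jap k * u k) * L2_set v (idx K)"
    using u jap_pos by (intro rconv_young K) (simp add: less_imp_le)
  also have "\<dots> \<le> (sqrt 6 * L2_set u (idx K)) * L2_set v (idx K)"
    by (intro mult_right_mono *) simp
  finally show ?thesis by (simp add: mult_ac)
qed

lemma snorm_eq_L2_set: "snorm K \<sigma> y = L2_set (\<lambda>j. jap j powr \<sigma> * cmod (y j)) (idx K)"
proof -
  have "jap j powr (2 * \<sigma>) = (jap j powr \<sigma>)\<^sup>2" for j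
    using powr_add[of "jap j" \<sigma> \<sigma>] by (simp add: power2_eq_square)
  then show ?thesis
    unfolding snorm_def L2_set_def by (simp add: power_mult_distrib)
qed

definition alg_const :: "real \<Rightarrow> real" where
  "alg_const m = 3 * sqrt 6 * 2 powr m"

lemma alg_const_nonneg: "0 \<le> alg_const m"
  by (simp add: alg_const_def)

text \<open>
Multiplication \<open>H\<^sup>a \<times> H\<^sup>b \<rightarrow> H\<^sup>c\<close>, with a constant independent of \<open>K\<close>.  Putting the weights on the factors,
the three summands of \<open>triangle_weight\<close> leave three convolutions of \<open>\<ell>\<^sup>2\<close> sequences with one factor
\<open>1 / jap\<close> on the first factor, on the second factor, or outside; each is bounded on \<open>\<ell>\<^sup>2\<close>.

It is used for \<open>(a, b, c) = (s + 1, \<sigma>, \<sigma>)\<close> with \<open>s - 1 \<le> \<sigma> \<le> s + 1\<close>, in both orders, and for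
\<open>(s, s, s - 1)\<close>.
\<close>

lemma snorm_dconv_le:
  assumes K: "1 \<le> K"
    and sums: "0 \<le> a + b" "c \<le> a" "c \<le> b" "1 \<le> a + b - c"
    and le: "\<bar>a\<bar> \<le> m" "\<bar>b\<bar> \<le> m" "\<bar>c\<bar> \<le> m"
  shows "snorm K c (dconv K u v) \<le> alg_const m * (snorm K a u * snorm K b v)"
proof -
  define U where "U k = jap k powr a * cmod (u k)" for k
  define V where "V k = jap k powr b * cmod (v k)" for k
  have U0: "0 \<le> U k" and V0: "0 \<le> V k" for k by (auto simp: U_def V_def)
  let ?N = "\<lambda>w. L2_set w (idx K)"
  let ?Y = "\<lambda>j. rconv K (\<lambda>k. 1 / jap k * U k) V j + rconv K (\<lambda>k. 1 / jap k * V k) U j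
      + 1 / jap j * (?N U * ?N V)"
  have pointwise: "jap j powr c * cmod (dconv K u v j) \<le> 2 powr m * ?Y j" if j: "j \<in> idx K" for j
  proof -
    have summand: "jap j powr c * (cmod (u k) * cmod (v l))
        \<le> 2 powr m * (1 / jap k * U k * V l + 1 / jap l * V l * U k + 1 / jap j * (U k * V l))"
      if k: "k \<in> idx K" and l: "l = red K (j - k)" for k l
    proof -
      have "[k + l = k + (j - k)] (mod (2 * K))" unfolding l by (intro cong_add red_cong) simp
      then have "[k + l = j] (mod (2 * K))" by simp
      moreover have "l \<in> idx K" using l red_mem K by simp
      ultimately have tri: "jap j \<le> jap k + jap l" "jap k \<le> jap j + jap l" "jap l \<le> jap j + jap k"
        using jap_triangle k j by blast+
      have w: "jap k powr -a * jap l powr -b * jap j powr -(-c)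
          \<le> 2 powr m * (1 / jap k + 1 / jap l + 1 / jap j)"
        by (rule triangle_weight) (use jap_ge_1 tri sums le in auto)
      have "cmod (u k) = jap k powr -a * U k" "cmod (v l) = jap l powr -b * V l"
        using jap_pos[of k] jap_pos[of l] by (simp_all add: U_def V_def powr_minus)
      then have "jap j powr c * (cmod (u k) * cmod (v l))
          = (jap k powr -a * jap l powr -b * jap j powr -(-c)) * (U k * V l)"
        by simp
      also have "\<dots> \<le> (2 powr m * (1 / jap k + 1 / jap l + 1 / jap j)) * (U k * V l)"
        using w U0 V0 by (intro mult_right_mono) auto
      finally show ?thesis by (simp add: algebra_simps)
    qed
    have "jap j powr c * cmod (dconv K u v j)
        \<le> jap j powr c * (\<Sum>k\<in>idx K. cmod (u k) * cmod (v (red K (j - k))))"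
      unfolding dconv_eq[OF K]
      by (intro mult_left_mono sum_norm_le) (auto simp: norm_mult)
    also have "\<dots> \<le> (\<Sum>k\<in>idx K. 2 powr m * (1 / jap k * U k * V (red K (j - k))
        + 1 / jap (red K (j - k)) * V (red K (j - k)) * U k + 1 / jap j * (U k * V (red K (j - k)))))"
      unfolding sum_distrib_left by (intro sum_mono summand) auto
    also have "\<dots> = 2 powr m * (rconv K (\<lambda>k. 1 / jap k * U k) V j
        + rconv K U (\<lambda>k. 1 / jap k * V k) j + 1 / jap j * (\<Sum>k\<in>idx K. U k * V (red K (j - k))))"
      by (simp add: rconv_def sum_distrib_left[symmetric] sum.distrib sum_divide_distrib mult_ac)
    also have "\<dots> \<le> 2 powr m * ?Y j"
    proof -
      have "(\<Sum>k\<in>idx K. U k * V (red K (j - k))) \<le> ?N U * ?N V"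
        using sum_mult_le_L2_set[of U "\<lambda>k. V (red K (j - k))" "idx K"]
        by (simp add: L2_set_red_reflect[OF K])
      then have "1 / jap j * (\<Sum>k\<in>idx K. U k * V (red K (j - k))) \<le> 1 / jap j * (?N U * ?N V)"
        using jap_pos[of j] by (intro mult_left_mono) auto
      then show ?thesis
        unfolding rconv_commute[OF K, of U] by (rule mult_left_mono[OF add_left_mono]) simp
    qed
    finally show ?thesis .
  qed
  have "snorm K c (dconv K u v) \<le> ?N (\<lambda>j. 2 powr m * ?Y j)"
    unfolding snorm_eq_L2_set by (intro L2_set_mono pointwise) auto
  also have "\<dots> = 2 powr m * ?N ?Y"
    by (simp add: L2_set_right_distrib)
  also have "?N ?Y \<le> ?N (\<lambda>j. rconv K (\<lambda>k. 1 / jap k * U k) V j + rconv K (\<lambda>k. 1 / jap k * V k) U j)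
      + ?N (\<lambda>j. 1 / jap j * (?N U * ?N V))"
    by (rule L2_set_triangle_ineq)
  also have "\<dots> \<le> (?N (rconv K (\<lambda>k. 1 / jap k * U k) V) + ?N (rconv K (\<lambda>k. 1 / jap k * V k) U))
      + ?N (\<lambda>j. 1 / jap j) * (?N U * ?N V)"
    by (intro add_mono L2_set_triangle_ineq) (simp add: L2_set_left_distrib)
  also have "\<dots> \<le> (sqrt 6 * (?N U * ?N V) + sqrt 6 * (?N V * ?N U)) + sqrt 6 * (?N U * ?N V)"
    by (intro add_mono rconv_weighted_young mult_right_mono L2_set_jap_inverse K U0 V0) auto
  also have "\<dots> = 3 * sqrt 6 * (?N U * ?N V)" by simp
  finally have "snorm K c (dconv K u v) \<le> 2 powr m * (3 * sqrt 6 * (?N U * ?N V))"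
    by simp
  moreover have "snorm K a u = ?N U" "snorm K b v = ?N V"
    unfolding snorm_eq_L2_set U_def V_def by simp_all
  ultimately show ?thesis
    by (simp add: alg_const_def mult_ac)
qed

section \<open>Sobolev norms of trigonometric polynomials\<close>

lemma snorm_nonneg [simp]: "0 \<le> snorm K \<sigma> y"
  by (simp add: snorm_eq_L2_set)

lemma snorm_triangle: "snorm K \<sigma> (\<lambda>j. u j + v j) \<le> snorm K \<sigma> u + snorm K \<sigma> v"
proof -
  have "snorm K \<sigma> (\<lambda>j. u j + v j)
      \<le> L2_set (\<lambda>j. jap j powr \<sigma> * cmod (u j) + jap j powr \<sigma> * cmod (v j)) (idx K)"
    unfolding snorm_eq_L2_set distrib_left[symmetric]
    by (intro L2_set_mono mult_left_mono norm_triangle_ineq) auto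
  also have "\<dots> \<le> snorm K \<sigma> u + snorm K \<sigma> v"
    unfolding snorm_eq_L2_set by (rule L2_set_triangle_ineq)
  finally show ?thesis .
qed

lemma snorm_minus: "snorm K \<sigma> (\<lambda>j. - u j) = snorm K \<sigma> u"
  by (simp add: snorm_def)

lemma snorm_diff: "snorm K \<sigma> (\<lambda>j. u j - v j) \<le> snorm K \<sigma> u + snorm K \<sigma> v"
  using snorm_triangle[of K \<sigma> u "\<lambda>j. - v j"] by (simp add: snorm_minus)

lemma snorm_diff_commute: "snorm K \<sigma> (\<lambda>j. u j - v j) = snorm K \<sigma> (\<lambda>j. v j - u j)"
  by (simp add: snorm_def norm_minus_commute)

lemma snorm_le_weight:
  assumes "0 \<le> A"
    and "\<And>j. j \<in> idx K \<Longrightarrow> jap j powr \<sigma> * cmod (u j) \<le> A * (jap j powr \<rho> * cmod (v j))"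
  shows "snorm K \<sigma> u \<le> A * snorm K \<rho> v"
  unfolding snorm_eq_L2_set L2_set_right_distrib[OF assms(1)]
  using assms(2) by (intro L2_set_mono) auto

text \<open>
Fourier multipliers: growth of the symbol costs derivatives, decay gains them.
\<close>

lemma snorm_multiplier:
  fixes m :: "int \<Rightarrow> real"
  assumes "0 \<le> A" and "\<And>j. j \<in> idx K \<Longrightarrow> \<bar>m j\<bar> \<le> A * jap j powr (\<rho> - \<sigma>)"
  shows "snorm K \<sigma> (\<lambda>j. m j *\<^sub>R v j) \<le> A * snorm K \<rho> v"
proof (rule snorm_le_weight[OF assms(1)])
  fix j assume j: "j \<in> idx K"
  have "jap j powr \<sigma> * cmod (m j *\<^sub>R v j) = jap j powr \<sigma> * \<bar>m j\<bar> * cmod (v j)"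
    by simp
  also have "\<dots> \<le> jap j powr \<sigma> * (A * jap j powr (\<rho> - \<sigma>)) * cmod (v j)"
    using assms(2)[OF j] by (intro mult_right_mono mult_left_mono) auto
  also have "\<dots> = A * ((jap j powr \<sigma> * jap j powr (\<rho> - \<sigma>)) * cmod (v j))"
    by simp
  also have "jap j powr \<sigma> * jap j powr (\<rho> - \<sigma>) = jap j powr \<rho>"
    by (simp add: powr_add[symmetric])
  finally show "jap j powr \<sigma> * cmod (m j *\<^sub>R v j) \<le> A * (jap j powr \<rho> * cmod (v j))" .
qed

lemma snorm_scaleR: "snorm K \<sigma> (\<lambda>j. a *\<^sub>R v j) = \<bar>a\<bar> * snorm K \<sigma> v"
  unfolding snorm_eq_L2_set
  by (subst L2_set_right_distrib) (auto simp: mult_ac)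

lemma snorm_mono_index: "\<sigma> \<le> \<rho> \<Longrightarrow> snorm K \<sigma> v \<le> snorm K \<rho> v"
  using snorm_multiplier[of 1 K "\<lambda>_. 1" \<rho> \<sigma> v] jap_ge_1
  by (simp add: ge_one_powr_ge_zero)

lemma powr_minus_le_sum_inverse:
  fixes x :: real
  assumes "0 < x" "-1 \<le> \<alpha>" "\<alpha> \<le> 1"
  shows "x powr -\<alpha> \<le> x + 1 / x"
proof (cases "x \<le> 1")
  case True
  have "x powr -\<alpha> \<le> x powr -1"
    using assms True by (intro powr_mono') auto
  also have "\<dots> = 1 / x" using assms by (simp add: powr_minus divide_inverse)
  finally show ?thesis using assms by simp
next
  case False
  then have "x powr -\<alpha> \<le> x powr 1"
    using assms by (intro powr_mono) auto
  also have "\<dots> = x" using assms by simp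
  finally show ?thesis using assms by (simp add: add_increasing2)
qed

text \<open>
Estimates that lose or gain a full derivative against a factor \<open>h\<close> imply the intermediate ones with a
factor \<open>h powr \<alpha>\<close>, because \<open>x powr (- \<alpha>) \<le> x + 1 / x\<close> for \<open>x = h * jap j\<close>.  This treats all
\<open>\<alpha> \<in> [-1, 1]\<close> at once.
\<close>

lemma snorm_interpolation:
  assumes h: "0 < h" and \<alpha>: "-1 \<le> \<alpha>" "\<alpha> \<le> 1"
  shows "snorm K (\<sigma> - \<alpha>) v \<le> h powr \<alpha> * (h * snorm K (\<sigma> + 1) v + 1 / h * snorm K (\<sigma> - 1) v)"
proof -
  have "snorm K (\<sigma> - \<alpha>) v \<le> L2_set (\<lambda>j. h powr \<alpha> * (h * (jap j powr (\<sigma> + 1) * cmod (v j))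
      + 1 / h * (jap j powr (\<sigma> - 1) * cmod (v j)))) (idx K)"
    unfolding snorm_eq_L2_set
  proof (rule L2_set_mono)
    fix j
    have j: "0 < jap j" by (rule jap_pos)
    have "jap j powr (\<sigma> - \<alpha>) = h powr \<alpha> * ((h * jap j) powr -\<alpha> * jap j powr \<sigma>)"
      using h j by (simp add: powr_mult powr_minus powr_diff field_simps)
    also have "\<dots> \<le> h powr \<alpha> * ((h * jap j + 1 / (h * jap j)) * jap j powr \<sigma>)"
      using h j \<alpha> by (intro mult_left_mono mult_right_mono powr_minus_le_sum_inverse) auto
    also have "(h * jap j + 1 / (h * jap j)) * jap j powr \<sigma>
        = h * jap j powr (\<sigma> + 1) + 1 / h * jap j powr (\<sigma> - 1)"
      using h j by (simp add: powr_add powr_diff algebra_simps)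
    finally have "jap j powr (\<sigma> - \<alpha>) * cmod (v j)
        \<le> h powr \<alpha> * (h * jap j powr (\<sigma> + 1) + 1 / h * jap j powr (\<sigma> - 1)) * cmod (v j)"
      by (rule mult_right_mono) simp
    then show "jap j powr (\<sigma> - \<alpha>) * cmod (v j) \<le> h powr \<alpha> * (h * (jap j powr (\<sigma> + 1) * cmod (v j))
      + 1 / h * (jap j powr (\<sigma> - 1) * cmod (v j)))"
      by (simp add: algebra_simps)
  qed simp
  also have "\<dots> = h powr \<alpha> * L2_set (\<lambda>j. h * (jap j powr (\<sigma> + 1) * cmod (v j))
      + 1 / h * (jap j powr (\<sigma> - 1) * cmod (v j))) (idx K)"
    by (simp add: L2_set_right_distrib)
  also have "\<dots> \<le> h powr \<alpha> * (L2_set (\<lambda>j. h * (jap j powr (\<sigma> + 1) * cmod (v j))) (idx K)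
      + L2_set (\<lambda>j. 1 / h * (jap j powr (\<sigma> - 1) * cmod (v j))) (idx K))"
    by (intro mult_left_mono L2_set_triangle_ineq) simp
  also have "\<dots> = h powr \<alpha> * (h * snorm K (\<sigma> + 1) v + 1 / h * snorm K (\<sigma> - 1) v)"
    unfolding snorm_eq_L2_set
    by (simp only: L2_set_right_distrib[of h, OF less_imp_le[OF h]]
        L2_set_right_distrib[of "1 / h", OF less_imp_le[OF zero_less_divide_1_iff[THEN iffD2, OF h]]])
  finally show ?thesis .
qed

text \<open>
Mean value inequality for the weighted norm; it takes the place of bounds for vector-valued integrals.
The increment \<open>z\<close> is tested against itself: the scalar function \<open>t \<mapsto> (z, \<phi> t)\<close> obeys the mean
value theorem, and its derivative is at most \<open>B\<close> times the norm of \<open>z\<close>.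
\<close>

lemma snorm_mean_value:
  fixes \<phi> :: "real \<Rightarrow> int \<Rightarrow> complex"
  assumes "a \<le> b"
    and deriv: "\<And>t j. t \<in> {a..b} \<Longrightarrow> j \<in> idx K \<Longrightarrow>
      ((\<lambda>\<tau>. \<phi> \<tau> j) has_vector_derivative \<phi>' t j) (at t within {a..b})"
    and bound: "\<And>t. t \<in> {a..b} \<Longrightarrow> snorm K \<sigma> (\<phi>' t) \<le> B"
  shows "snorm K \<sigma> (\<lambda>j. \<phi> b j - \<phi> a j) \<le> B * (b - a)"
proof -
  define w where "w j = jap j powr \<sigma>" for j
  define z where "z j = \<phi> b j - \<phi> a j" for j
  define ip where "ip u = (\<Sum>j\<in>idx K. (w j)\<^sup>2 * (z j \<bullet> u j))" for u
  have ip_le: "ip u \<le> snorm K \<sigma> z * snorm K \<sigma> u" for u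
  proof -
    have "ip u \<le> (\<Sum>j\<in>idx K. (w j * cmod (z j)) * (w j * cmod (u j)))"
      unfolding ip_def
    proof (rule sum_mono)
      fix j
      have "(w j)\<^sup>2 * (z j \<bullet> u j) \<le> (w j)\<^sup>2 * (cmod (z j) * cmod (u j))"
        by (intro mult_left_mono norm_cauchy_schwarz) simp
      then show "(w j)\<^sup>2 * (z j \<bullet> u j) \<le> (w j * cmod (z j)) * (w j * cmod (u j))"
        by (simp add: power2_eq_square mult_ac)
    qed
    also have "\<dots> \<le> snorm K \<sigma> z * snorm K \<sigma> u"
      unfolding snorm_eq_L2_set w_def by (rule sum_mult_le_L2_set)
    finally show ?thesis .
  qed
  have ip_self: "ip z = (snorm K \<sigma> z)\<^sup>2"
    unfolding ip_def snorm_eq_L2_set w_def L2_set_def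
    by (simp add: sum_nonneg power_mult_distrib power2_norm_eq_inner)
  have "\<exists>t\<in>{a..b}. ip (\<phi> b) - ip (\<phi> a) = (\<lambda>x. x * ip (\<phi>' t)) (b - a)"
  proof (rule mvt_very_simple[OF assms(1)])
    fix t assume t: "a \<le> t" "t \<le> b"
    have "((\<lambda>\<tau>. \<phi> \<tau> j) has_derivative (\<lambda>x. x *\<^sub>R \<phi>' t j)) (at t within {a..b})" if "j \<in> idx K" for j
      using deriv[of t j] t that by (simp add: has_vector_derivative_def)
    then have "((\<lambda>\<tau>. ip (\<phi> \<tau>)) has_derivative
        (\<lambda>x. \<Sum>j\<in>idx K. (w j)\<^sup>2 * (z j \<bullet> (x *\<^sub>R \<phi>' t j)))) (at t within {a..b})"
      unfolding ip_def
      by (intro has_derivative_sum has_derivative_mult_right has_derivative_inner_right)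
    then show "((\<lambda>\<tau>. ip (\<phi> \<tau>)) has_derivative (\<lambda>x. x * ip (\<phi>' t))) (at t within {a..b})"
      by (simp add: ip_def sum_distrib_left mult_ac)
  qed
  then obtain t where t: "t \<in> {a..b}" and eq: "ip (\<phi> b) - ip (\<phi> a) = (b - a) * ip (\<phi>' t)"
    by auto
  have "ip z = ip (\<phi> b) - ip (\<phi> a)"
    unfolding ip_def z_def by (simp add: inner_diff_right right_diff_distrib sum_subtractf)
  also have "\<dots> \<le> (b - a) * (snorm K \<sigma> z * B)"
    unfolding eq using assms(1) order_trans[OF ip_le mult_left_mono[OF bound[OF t]]]
    by (intro mult_left_mono) auto
  finally have le: "snorm K \<sigma> z * snorm K \<sigma> z \<le> snorm K \<sigma> z * (B * (b - a))"
    unfolding ip_self by (simp add: power2_eq_square mult_ac)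
  have "0 \<le> B" using order_trans[OF snorm_nonneg bound[of a]] assms(1) by auto
  then have "snorm K \<sigma> z \<le> B * (b - a)"
  proof (cases "snorm K \<sigma> z = 0")
    case False
    then have "0 < snorm K \<sigma> z" by (simp add: less_le)
    then show ?thesis using le by simp
  qed (use assms(1) in simp)
  then show ?thesis by (simp add: z_def[abs_def])
qed

section \<open>The power nonlinearity\<close>

lemma nonlin_Suc_0: "nonlin K (Suc 0) y = y"
  by (simp add: nonlin_def)

lemma nonlin_Suc_Suc: "nonlin K (Suc (Suc n)) y = dconv K y (nonlin K (Suc n) y)"
  by (simp add: nonlin_def)

lemma dconv_diff_left:
  "1 \<le> K \<Longrightarrow> dconv K (\<lambda>j. u j - v j) w i = dconv K u w i - dconv K v w i"
  by (simp add: dconv_eq left_diff_distrib sum_subtractf)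

lemma dconv_diff_right:
  "1 \<le> K \<Longrightarrow> dconv K w (\<lambda>j. u j - v j) i = dconv K w u i - dconv K w v i"
  by (simp add: dconv_eq right_diff_distrib sum_subtractf)

lemma snorm_nonlin_le:
  assumes K: "1 \<le> K" and s: "0 \<le> s" and y: "snorm K (s + 1) y \<le> R"
  shows "snorm K (s + 1) (nonlin K (Suc n) y) \<le> (alg_const (s + 1) * R) ^ n * R"
proof (induction n)
  case 0
  then show ?case using y by (simp add: nonlin_Suc_0)
next
  case (Suc n)
  let ?B = "alg_const (s + 1)"
  have R: "0 \<le> R" using y snorm_nonneg order_trans by blast
  have "snorm K (s + 1) (nonlin K (Suc (Suc n)) y)
      \<le> ?B * (snorm K (s + 1) y * snorm K (s + 1) (nonlin K (Suc n) y))"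
    unfolding nonlin_Suc_Suc using s by (intro snorm_dconv_le K) auto
  also have "\<dots> \<le> ?B * (R * ((?B * R) ^ n * R))"
    by (intro mult_left_mono mult_mono Suc y R alg_const_nonneg) auto
  finally show ?case by simp
qed

lemma snorm_nonlin_diff_le:
  assumes K: "1 \<le> K" and s: "0 \<le> s" and \<sigma>: "s - 1 \<le> \<sigma>" "\<sigma> \<le> s + 1"
    and y: "snorm K (s + 1) y \<le> R" and z: "snorm K (s + 1) z \<le> R"
  shows "snorm K \<sigma> (\<lambda>j. nonlin K (Suc n) y j - nonlin K (Suc n) z j)
    \<le> real (Suc n) * (alg_const (s + 1) * R) ^ n * snorm K \<sigma> (\<lambda>j. y j - z j)"
proof (induction n)
  case 0
  then show ?case by (simp add: nonlin_Suc_0)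
next
  case (Suc n)
  define B where "B = alg_const (s + 1)"
  define d where "d = snorm K \<sigma> (\<lambda>j. y j - z j)"
  let ?F = "nonlin K (Suc n)"
  have R: "0 \<le> R" using y snorm_nonneg order_trans by blast
  have B: "0 \<le> B" by (simp add: B_def alg_const_nonneg)
  have "snorm K \<sigma> (\<lambda>j. nonlin K (Suc (Suc n)) y j - nonlin K (Suc (Suc n)) z j)
      = snorm K \<sigma> (\<lambda>j. dconv K (\<lambda>i. y i - z i) (?F y) j + dconv K z (\<lambda>i. ?F y i - ?F z i) j)"
    unfolding nonlin_Suc_Suc by (simp add: dconv_diff_left dconv_diff_right K)
  also have "\<dots> \<le> snorm K \<sigma> (dconv K (\<lambda>i. y i - z i) (?F y)) + snorm K \<sigma> (dconv K z (\<lambda>i. ?F y i - ?F z i))"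
    by (rule snorm_triangle)
  also have "\<dots> \<le> B * (d * snorm K (s + 1) (?F y)) + B * (snorm K (s + 1) z * snorm K \<sigma> (\<lambda>i. ?F y i - ?F z i))"
    unfolding B_def d_def using s \<sigma> by (intro add_mono snorm_dconv_le K) auto
  also have "\<dots> \<le> B * (d * ((B * R) ^ n * R)) + B * (R * (real (Suc n) * (B * R) ^ n * d))"
    using Suc snorm_nonlin_le[OF K s y] z R B unfolding B_def[symmetric] d_def[symmetric]
    by (intro add_mono mult_left_mono mult_mono) (auto simp: d_def)
  also have "\<dots> = real (Suc (Suc n)) * (B * R) ^ Suc n * d"
    by (simp add: algebra_simps)
  finally show ?case by (simp add: B_def d_def)
qed

text \<open>
The derivative of \<open>nonlin K (Suc n)\<close> at \<open>y\<close> in the direction \<open>v\<close>, built up by the product rule; the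
argument \<open>n\<close> is the exponent minus one.
\<close>

fun nonlin_deriv :: "int \<Rightarrow> nat \<Rightarrow> (int \<Rightarrow> complex) \<Rightarrow> (int \<Rightarrow> complex) \<Rightarrow> int \<Rightarrow> complex" where
  "nonlin_deriv K 0 y v = v"
| "nonlin_deriv K (Suc n) y v =
    (\<lambda>j. dconv K v (nonlin K (Suc n) y) j + dconv K y (nonlin_deriv K n y v) j)"

lemma dconv_has_vector_derivative:
  assumes K: "1 \<le> K"
    and u: "\<And>j. j \<in> idx K \<Longrightarrow> ((\<lambda>\<tau>. u \<tau> j) has_vector_derivative u' j) (at t within I)"
    and v: "\<And>j. j \<in> idx K \<Longrightarrow> ((\<lambda>\<tau>. v \<tau> j) has_vector_derivative v' j) (at t within I)"
  shows "((\<lambda>\<tau>. dconv K (u \<tau>) (v \<tau>) j) has_vector_derivative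
    dconv K u' (v t) j + dconv K (u t) v' j) (at t within I)"
proof -
  have "((\<lambda>\<tau>. \<Sum>k\<in>idx K. u \<tau> k * v \<tau> (red K (j - k))) has_vector_derivative
      (\<Sum>k\<in>idx K. u t k * v' (red K (j - k)) + u' k * v t (red K (j - k)))) (at t within I)"
    by (intro has_vector_derivative_sum has_vector_derivative_mult u v red_mem K)
  then show ?thesis
    by (simp add: dconv_eq[OF K] sum.distrib add.commute)
qed

lemma nonlin_has_vector_derivative:
  assumes K: "1 \<le> K"
    and y: "\<And>j. j \<in> idx K \<Longrightarrow> ((\<lambda>\<tau>. y \<tau> j) has_vector_derivative v j) (at t within I)"
    and j: "j \<in> idx K"
  shows "((\<lambda>\<tau>. nonlin K (Suc n) (y \<tau>) j) has_vector_derivative nonlin_deriv K n (y t) v j) (at t within I)"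
  using j
proof (induction n arbitrary: j)
  case 0
  then show ?case using y by (simp add: nonlin_Suc_0)
next
  case (Suc n)
  then show ?case
    unfolding nonlin_Suc_Suc nonlin_deriv.simps by (intro dconv_has_vector_derivative K y)
qed

lemma snorm_nonlin_deriv_le:
  assumes K: "1 \<le> K" and s: "0 \<le> s" and y: "snorm K (s + 1) y \<le> R"
  shows "snorm K s (nonlin_deriv K n y v) \<le> real (Suc n) * (alg_const (s + 1) * R) ^ n * snorm K s v"
proof (induction n)
  case 0
  then show ?case by simp
next
  case (Suc n)
  define B where "B = alg_const (s + 1)"
  define d where "d = snorm K s v"
  have R: "0 \<le> R" using y snorm_nonneg order_trans by blast
  have B: "0 \<le> B" by (simp add: B_def alg_const_nonneg)
  have "snorm K s (nonlin_deriv K (Suc n) y v)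
      \<le> snorm K s (dconv K v (nonlin K (Suc n) y)) + snorm K s (dconv K y (nonlin_deriv K n y v))"
    unfolding nonlin_deriv.simps by (rule snorm_triangle)
  also have "\<dots> \<le> B * (d * snorm K (s + 1) (nonlin K (Suc n) y))
      + B * (snorm K (s + 1) y * snorm K s (nonlin_deriv K n y v))"
    unfolding B_def d_def using s by (intro add_mono snorm_dconv_le K) auto
  also have "\<dots> \<le> B * (d * ((B * R) ^ n * R)) + B * (R * (real (Suc n) * (B * R) ^ n * d))"
    using Suc snorm_nonlin_le[OF K s y] y R B unfolding B_def[symmetric] d_def[symmetric]
    by (intro add_mono mult_left_mono mult_mono) (auto simp: d_def)
  also have "\<dots> = real (Suc (Suc n)) * (B * R) ^ Suc n * d"
    by (simp add: algebra_simps)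
  finally show ?case by (simp add: B_def d_def)
qed

text \<open>
In the norm of order \<open>s - 1\<close> the derivative of the nonlinearity is Lipschitz along curves whose velocity
is only bounded in the norm of order \<open>s\<close>.  The difference of two products is expanded into four products
with one difference each; the products of a velocity with a position difference are of the type
\<open>H\<^sup>s \<times> H\<^sup>s \<rightarrow> H\<^sup>s\<^sup>-\<^sup>1\<close>.
\<close>

lemma snorm_nonlin_deriv_diff_le:
  assumes K: "1 \<le> K" and s: "0 \<le> s"
    and y: "snorm K (s + 1) y \<le> R" and z: "snorm K (s + 1) z \<le> R"
    and v: "snorm K s v \<le> R" and w: "snorm K s w \<le> R"
  shows "snorm K (s - 1) (\<lambda>j. nonlin_deriv K n y v j - nonlin_deriv K n z w j)
    \<le> (real (Suc n))\<^sup>2 * (alg_const (s + 1) * R) ^ n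
      * (snorm K (s - 1) (\<lambda>j. v j - w j) + snorm K s (\<lambda>j. y j - z j))"
proof (induction n)
  case 0
  then show ?case by simp
next
  case (Suc n)
  define B where "B = alg_const (s + 1)"
  define N where "N = real (Suc n)"
  define X where "X = (B * R) ^ n"
  define d where "d = snorm K s (\<lambda>j. y j - z j)"
  define e where "e = snorm K (s - 1) (\<lambda>j. v j - w j)"
  let ?F = "nonlin K (Suc n)"
  let ?D = "nonlin_deriv K n"
  let ?n = "snorm K (s - 1)"
  have R: "0 \<le> R" using y snorm_nonneg order_trans by blast
  have B: "0 \<le> B" by (simp add: B_def alg_const_nonneg)
  have d: "0 \<le> d" and e: "0 \<le> e" and X: "0 \<le> X" and N: "0 \<le> N"
    by (auto simp: d_def e_def X_def B R N_def)
  have "nonlin_deriv K (Suc n) y v j - nonlin_deriv K (Suc n) z w j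
      = (dconv K (\<lambda>i. v i - w i) (?F y) j + dconv K w (\<lambda>i. ?F y i - ?F z i) j)
      + (dconv K (\<lambda>i. y i - z i) (?D y v) j + dconv K z (\<lambda>i. ?D y v i - ?D z w i) j)" for j
    by (simp add: dconv_diff_left dconv_diff_right K)
  then have "?n (\<lambda>j. nonlin_deriv K (Suc n) y v j - nonlin_deriv K (Suc n) z w j)
      = ?n (\<lambda>j. (dconv K (\<lambda>i. v i - w i) (?F y) j + dconv K w (\<lambda>i. ?F y i - ?F z i) j)
      + (dconv K (\<lambda>i. y i - z i) (?D y v) j + dconv K z (\<lambda>i. ?D y v i - ?D z w i) j))"
    by presburger
  also have "\<dots> \<le> (?n (dconv K (\<lambda>i. v i - w i) (?F y)) + ?n (dconv K w (\<lambda>i. ?F y i - ?F z i)))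
      + (?n (dconv K (\<lambda>i. y i - z i) (?D y v)) + ?n (dconv K z (\<lambda>i. ?D y v i - ?D z w i)))"
    by (intro order_trans[OF snorm_triangle] add_mono snorm_triangle)
  also have "\<dots> \<le> (B * (e * snorm K (s + 1) (?F y)) + B * (snorm K s w * snorm K s (\<lambda>i. ?F y i - ?F z i)))
      + (B * (d * snorm K s (?D y v)) + B * (snorm K (s + 1) z * ?n (\<lambda>i. ?D y v i - ?D z w i)))"
    unfolding B_def d_def e_def using s by (intro add_mono snorm_dconv_le K) auto
  also have "\<dots> \<le> (B * (e * (X * R)) + B * (R * (N * X * d)))
      + (B * (d * (N * X * R)) + B * (R * (N\<^sup>2 * X * (e + d))))"
  proof -
    have "snorm K (s + 1) (?F y) \<le> X * R"
      unfolding X_def B_def by (rule snorm_nonlin_le[OF K s y])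
    moreover have "snorm K s (\<lambda>i. ?F y i - ?F z i) \<le> N * X * d"
      unfolding X_def B_def N_def d_def by (rule snorm_nonlin_diff_le[OF K s _ _ y z]) auto
    moreover have "snorm K s (?D y v) \<le> N * X * R"
    proof -
      have "snorm K s (?D y v) \<le> N * X * snorm K s v"
        unfolding X_def B_def N_def by (rule snorm_nonlin_deriv_le[OF K s y])
      also have "\<dots> \<le> N * X * R" using v N X by (intro mult_left_mono) auto
      finally show ?thesis .
    qed
    moreover have "?n (\<lambda>i. ?D y v i - ?D z w i) \<le> N\<^sup>2 * X * (e + d)"
      using Suc unfolding X_def B_def N_def d_def e_def .
    ultimately show ?thesis
      using w z d e B R by (intro add_mono mult_left_mono mult_mono) auto
  qed
  also have "\<dots> = B * R * X * ((1 + N\<^sup>2) * e + (2 * N + N\<^sup>2) * d)"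
    by (simp add: algebra_simps power2_eq_square)
  also have "\<dots> \<le> B * R * X * ((N + 1)\<^sup>2 * e + (N + 1)\<^sup>2 * d)"
    using B R X N d e by (intro mult_left_mono add_mono mult_right_mono) (auto simp: power2_eq_square algebra_simps)
  also have "\<dots> = (real (Suc (Suc n)))\<^sup>2 * (B * R) ^ Suc n * (e + d)"
    by (simp add: X_def N_def algebra_simps)
  finally show ?case by (simp add: B_def d_def e_def)
qed

section \<open>Filter functions of the integrator\<close>

text \<open>
\<open>cos_integral u w\<close> is the integral of \<open>\<lambda>x. cos (x * w)\<close> over \<open>[0, u]\<close>, that is \<open>u * sinc (u * w)\<close>, and
\<open>cos_integral2\<close> is its antiderivative in \<open>u\<close>.  Writing the integrator with these functions removes
the case distinction at frequency zero from the differential calculus.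
\<close>

definition cos_integral :: "real \<Rightarrow> real \<Rightarrow> real" where
  "cos_integral u w = (if w = 0 then u else sin (u * w) / w)"

definition cos_integral2 :: "real \<Rightarrow> real \<Rightarrow> real" where
  "cos_integral2 u w = (if w = 0 then u\<^sup>2 / 2 else (1 - cos (u * w)) / w\<^sup>2)"

lemma abs_cos_integral_le:
  assumes "0 \<le> u"
  shows "\<bar>cos_integral u w\<bar> \<le> u"
proof (cases "w = 0")
  case False
  have "\<bar>sin (u * w)\<bar> \<le> \<bar>u * w\<bar>" by (rule abs_sin_x_le_abs_x)
  then show ?thesis using assms False
    by (simp add: cos_integral_def abs_mult divide_simps)
qed (use assms in \<open>simp add: cos_integral_def\<close>)

lemma abs_cos_integral_jap_le:
  assumes "0 \<le> u" "u \<le> 1"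
  shows "\<bar>cos_integral u (omega j)\<bar> \<le> 1 / jap j"
proof (cases "omega j = 0")
  case False
  then show ?thesis using jap_eq_omega[OF False] jap_pos[of j]
    by (simp add: cos_integral_def divide_right_mono)
qed (use assms jap_eq_1 in \<open>simp add: cos_integral_def\<close>)

text \<open>
This identity is the reason why Condition \<open>A(\<beta>)\<close> compares \<open>bb\<close> with half the square of \<open>sinc\<close>: that
value integrates a constant nonlinearity exactly.
\<close>

lemma cos_integral2_eq_sinc: "cos_integral2 h w = h\<^sup>2 * ((sinc (h * w / 2))\<^sup>2 / 2)"
proof (cases "w = 0 \<or> h = 0")
  case False
  have "cos (h * w) = 1 - 2 * (sin (h * w / 2))\<^sup>2"
    using cos_double_sin[of "h * w / 2"] by simp
  then show ?thesis using False
    by (simp add: cos_integral2_def power_divide field_simps)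
qed (auto simp: cos_integral2_def)

lemma has_derivative_cos_reversed:
  "((\<lambda>\<tau>. cos ((d - \<tau>) * w)) has_field_derivative w * sin ((d - t) * w)) (at t within S)"
  by (auto intro!: derivative_eq_intros)

lemma has_derivative_cos_integral_reversed:
  "((\<lambda>\<tau>. cos_integral (d - \<tau>) w) has_field_derivative - cos ((d - t) * w)) (at t within S)"
  by (cases "w = 0") (auto simp: cos_integral_def intro!: derivative_eq_intros)

lemma has_derivative_cos_integral2_reversed:
  "((\<lambda>\<tau>. cos_integral2 (d - \<tau>) w) has_field_derivative - cos_integral (d - t) w) (at t within S)"
  by (cases "w = 0")
    (auto simp: cos_integral_def cos_integral2_def power2_eq_square field_simps intro!: derivative_eq_intros)

lemma one_minus_cos_le_powr:
  fixes x :: real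
  assumes "0 \<le> x" "x \<le> X" "0 < X" "0 \<le> \<gamma>" "\<gamma> \<le> 2"
  shows "1 - cos x \<le> 2 * X powr \<gamma>"
proof (cases "X \<le> 1")
  case True
  have "cos x = 1 - 2 * (sin (x / 2))\<^sup>2"
    using cos_double_sin[of "x / 2"] by simp
  moreover have "(sin (x / 2))\<^sup>2 \<le> (x / 2)\<^sup>2"
    by (metis abs_sin_x_le_abs_x abs_le_square_iff)
  moreover have "x\<^sup>2 \<le> X\<^sup>2" using assms by (intro power_mono) auto
  moreover have "(x / 2)\<^sup>2 = x\<^sup>2 / 4" by (simp add: power_divide)
  ultimately have "1 - cos x \<le> X\<^sup>2" using zero_le_power2[of x] by linarith
  also have "X\<^sup>2 = X powr 2" using assms by simp
  also have "\<dots> \<le> X powr \<gamma>" using assms True by (intro powr_mono') auto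
  finally show ?thesis using powr_ge_zero[of X \<gamma>] by linarith
next
  case False
  then have "1 \<le> X powr \<gamma>" using assms by (intro ge_one_powr_ge_zero) auto
  then show ?thesis using cos_ge_minus_one[of x] by linarith
qed

lemma abs_sinc_le_1: "\<bar>sinc x\<bar> \<le> 1"
  using abs_sin_x_le_abs_x[of x] by (auto simp: divide_simps)

lemma half_sinc_squared_le_powr:
  fixes X :: real
  assumes "0 < X" "-1 \<le> \<alpha>" "\<alpha> \<le> 0"
  shows "(sinc (X / 2))\<^sup>2 / 2 \<le> 2 * X powr \<alpha>"
proof (cases "X \<le> 1")
  case True
  have "1 \<le> X powr \<alpha>"
    using assms True powr_mono'[of \<alpha> 0 X] by simp
  moreover have "(sinc (X / 2))\<^sup>2 \<le> 1"
    using abs_sinc_le_1[of "X / 2"] by (metis abs_square_le_1)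
  ultimately show ?thesis by linarith
next
  case False
  have "(sin (X / 2))\<^sup>2 \<le> 1" using abs_sin_le_one by (simp add: abs_square_le_1)
  then have "(sinc (X / 2))\<^sup>2 / 2 \<le> 2 / X\<^sup>2"
    using assms by (simp add: power_divide divide_simps)
  also have "2 / X\<^sup>2 = 2 * X powr -2"
    using assms by (simp add: powr_minus divide_inverse)
  also have "\<dots> \<le> 2 * X powr \<alpha>"
    using assms False by (intro mult_left_mono powr_mono) auto
  finally show ?thesis .
qed

text \<open>
Condition \<open>A(\<beta>)\<close> and its limit at frequency zero, combined into bounds by powers of \<open>h * jap j\<close> that hold
for every frequency and that have the same form for both signs of \<open>\<beta>\<close>.  For \<open>\<beta> \<le> 0\<close> the comparison with
\<open>sinc\<close> is free, since then both terms are separately of size \<open>(h * jap j) powr \<beta>\<close>.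
\<close>

lemma condA_defect:
  assumes A: "condA K h bb b c \<beta>" "condA_zero bb b c \<beta>" "condA_zero bb b c 0"
    and \<beta>: "-1 \<le> \<beta>" "\<beta> \<le> 1" and c: "1 \<le> c" and h: "0 < h" "h \<le> 1" and j: "j \<in> idx K"
  shows "\<bar>1 - b (h\<^sup>2 * (omega j)\<^sup>2)\<bar> \<le> c * (h * jap j) powr (1 + \<beta>)"
    and "\<beta> \<le> 0 \<Longrightarrow> \<bar>bb (h\<^sup>2 * (omega j)\<^sup>2)\<bar> \<le> c * (h * jap j) powr \<beta>"
    and "\<bar>(sinc (h * omega j / 2))\<^sup>2 / 2 - bb (h\<^sup>2 * (omega j)\<^sup>2)\<bar> \<le> (c + 2) * (h * jap j) powr \<beta>"
proof -
  have X: "0 < h * jap j" using h jap_pos by simp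
  show b: "\<bar>1 - b (h\<^sup>2 * (omega j)\<^sup>2)\<bar> \<le> c * (h * jap j) powr (1 + \<beta>)"
  proof (cases "omega j = 0")
    case True
    have "b 0 = 1" using A(3) by (simp add: condA_zero_def)
    then show ?thesis using True c by simp
  next
    case False
    then show ?thesis using A(1) j by (simp add: condA_def Let_def jap_eq_omega power_mult_distrib)
  qed
  show bb: "\<bar>bb (h\<^sup>2 * (omega j)\<^sup>2)\<bar> \<le> c * (h * jap j) powr \<beta>" if "\<beta> \<le> 0"
  proof (cases "omega j = 0")
    case True
    have "\<bar>bb 0\<bar> \<le> c" using A(3) by (simp add: condA_zero_def)
    also have "\<dots> \<le> c * h powr \<beta>"
      using c h that powr_mono'[of \<beta> 0 h] by simp
    finally show ?thesis using True by (simp add: jap_eq_1)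
  next
    case False
    then show ?thesis using A(1) j \<beta> that
      by (simp add: condA_def Let_def jap_eq_omega power_mult_distrib)
  qed
  define S where "S = (sinc (h * omega j / 2))\<^sup>2 / 2"
  have "\<bar>S - bb (h\<^sup>2 * (omega j)\<^sup>2)\<bar> \<le> (c + 2) * (h * jap j) powr \<beta>"
  proof (cases "0 < \<beta>")
    case True
    show ?thesis
    proof (cases "omega j = 0")
      case zero: True
      have "bb 0 = 1 / 2" using A(2) True by (simp add: condA_zero_def)
      then have "S - bb (h\<^sup>2 * (omega j)\<^sup>2) = 0" using zero by (simp add: S_def)
      then show ?thesis using c by simp
    next
      case False
      have "\<bar>S - bb ((h * omega j)\<^sup>2)\<bar> \<le> c * (h * omega j) powr \<beta>"
        unfolding S_def
        by (rule A(1)[unfolded condA_def Let_def, THEN bspec, OF j, THEN mp, OF False,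
            THEN conjunct2, THEN conjunct1, THEN mp, OF conjI[OF True \<beta>(2)]])
      also have "\<dots> \<le> (c + 2) * (h * omega j) powr \<beta>"
        by (intro mult_right_mono) auto
      finally show ?thesis
        unfolding jap_eq_omega[OF False] power_mult_distrib .
    qed
  next
    case False
    have "S \<le> 2 * (h * jap j) powr \<beta>"
    proof (cases "omega j = 0")
      case True
      have "1 \<le> h powr \<beta>" using h False powr_mono'[of \<beta> 0 h] by simp
      then show ?thesis using True by (simp add: jap_eq_1 S_def)
    next
      case nz: False
      have "0 < h * omega j" using X by (simp add: jap_eq_omega[OF nz])
      then show ?thesis
        unfolding S_def jap_eq_omega[OF nz]
        by (rule half_sinc_squared_le_powr) (use \<beta> False in auto)
    qed
    moreover have "\<bar>bb (h\<^sup>2 * (omega j)\<^sup>2)\<bar> \<le> c * (h * jap j) powr \<beta>" using bb False by simp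
    moreover have "0 \<le> S" unfolding S_def by simp
    ultimately show ?thesis unfolding distrib_right by linarith
  qed
  then show "\<bar>(sinc (h * omega j / 2))\<^sup>2 / 2 - bb (h\<^sup>2 * (omega j)\<^sup>2)\<bar> \<le> (c + 2) * (h * jap j) powr \<beta>"
    unfolding S_def .
qed

lemma erkn_mid_eq:
  "erkn_mid h u u' j = cos (h / 2 * omega j) *\<^sub>R u j + cos_integral (h / 2) (omega j) *\<^sub>R u' j"
  by (auto simp: erkn_mid_def cos_integral_def)

lemma snorm_erkn_mid_le:
  assumes "0 \<le> h" "h \<le> 1"
  shows "snorm K (\<sigma> + 1) (erkn_mid h u u') \<le> snorm K (\<sigma> + 1) u + snorm K \<sigma> u'"
proof -
  have "snorm K (\<sigma> + 1) (\<lambda>j. cos (h / 2 * omega j) *\<^sub>R u j) \<le> 1 * snorm K (\<sigma> + 1) u"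
  proof (rule snorm_multiplier)
    fix j
    show "\<bar>cos (h / 2 * omega j)\<bar> \<le> 1 * jap j powr (\<sigma> + 1 - (\<sigma> + 1))"
      using jap_pos[of j] by simp
  qed simp
  moreover have "snorm K (\<sigma> + 1) (\<lambda>j. cos_integral (h / 2) (omega j) *\<^sub>R u' j) \<le> 1 * snorm K \<sigma> u'"
  proof (rule snorm_multiplier)
    fix j
    have "\<bar>cos_integral (h / 2) (omega j)\<bar> \<le> 1 / jap j"
      using assms by (intro abs_cos_integral_jap_le) auto
    also have "1 / jap j = 1 * jap j powr (\<sigma> - (\<sigma> + 1))"
      using jap_pos[of j] by (simp add: powr_minus divide_inverse)
    finally show "\<bar>cos_integral (h / 2) (omega j)\<bar> \<le> 1 * jap j powr (\<sigma> - (\<sigma> + 1))" .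
  qed simp
  ultimately show ?thesis
    unfolding erkn_mid_eq[abs_def] by (intro order_trans[OF snorm_triangle]) linarith
qed

section \<open>Regularity of the exact solution in time\<close>

text \<open>
Bounds for \<open>f(y) = nonlin K p y\<close>, for its Lipschitz constant and for the Lipschitz constant of its
derivative on the ball of radius \<open>R\<close> in the norm of order \<open>s + 1\<close>.
\<close>

definition nl_bound :: "real \<Rightarrow> nat \<Rightarrow> real \<Rightarrow> real" where
  "nl_bound s p R = (alg_const (s + 1) * R) ^ (p - 1) * R"

definition nl_lip :: "real \<Rightarrow> nat \<Rightarrow> real \<Rightarrow> real" where
  "nl_lip s p R = real p * (alg_const (s + 1) * R) ^ (p - 1)"

definition nl_lip' :: "real \<Rightarrow> nat \<Rightarrow> real \<Rightarrow> real" where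
  "nl_lip' s p R = (real p)\<^sup>2 * (alg_const (s + 1) * R) ^ (p - 1)"

lemma nl_consts_nonneg:
  assumes "0 \<le> R"
  shows "0 \<le> nl_bound s p R" "0 \<le> nl_lip s p R" "0 \<le> nl_lip' s p R"
  using assms by (simp_all add: nl_bound_def nl_lip_def nl_lip'_def alg_const_nonneg)

lemma snorm_nonlin_bound:
  assumes "1 \<le> K" "1 \<le> p" "0 \<le> s" "snorm K (s + 1) y \<le> R"
  shows "snorm K (s + 1) (nonlin K p y) \<le> nl_bound s p R"
  using snorm_nonlin_le[OF assms(1,3,4), of "p - 1"] assms(2) by (simp add: nl_bound_def)

lemma snorm_nonlin_lip:
  assumes "1 \<le> K" "1 \<le> p" "0 \<le> s" "s - 1 \<le> \<sigma>" "\<sigma> \<le> s + 1"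
    and "snorm K (s + 1) y \<le> R" "snorm K (s + 1) z \<le> R"
  shows "snorm K \<sigma> (\<lambda>j. nonlin K p y j - nonlin K p z j)
    \<le> nl_lip s p R * snorm K \<sigma> (\<lambda>j. y j - z j)"
  using snorm_nonlin_diff_le[OF assms(1,3-7), of "p - 1"] assms(2) by (simp add: nl_lip_def)

lemma has_vector_derivative_affine:
  fixes f :: "real \<Rightarrow> 'a::real_normed_vector"
  assumes "(f has_vector_derivative f') (at (m + c * t) within S)"
    and "\<And>\<tau>. \<tau> \<in> U \<Longrightarrow> m + c * \<tau> \<in> S"
  shows "((\<lambda>\<tau>. f (m + c * \<tau>)) has_vector_derivative c *\<^sub>R f') (at t within U)"
proof -
  have "((\<lambda>\<tau>. m + c * \<tau>) has_vector_derivative c) (at t within U)"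
    by (auto intro!: derivative_eq_intros)
  moreover have "(f has_vector_derivative f') (at (m + c * t) within (\<lambda>\<tau>. m + c * \<tau>) ` U)"
    using assms by (intro has_vector_derivative_within_subset[OF assms(1)]) auto
  ultimately show ?thesis
    using vector_diff_chain_within by (fastforce simp: o_def)
qed

text \<open>
The constants in the locale depend on \<open>s\<close>, \<open>p\<close> and \<open>R\<close> only, not on \<open>K\<close> or on the solution; this
provides the uniformity asserted by the theorem.
\<close>

locale bounded_solution =
  fixes K :: int and p :: nat and s R t0 T :: real
    and y y' :: "real \<Rightarrow> int \<Rightarrow> complex"
  assumes K: "1 \<le> K" and p: "1 \<le> p" and s: "0 \<le> s"
    and solution: "semidiscrete_solution K p {t0..t0 + T} y y'"
    and bound: "\<And>t. t \<in> {t0..t0 + T} \<Longrightarrow> snorm K (s + 1) (y t) + snorm K s (y' t) \<le> R"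
begin

abbreviation I :: "real set" where "I \<equiv> {t0..t0 + T}"

abbreviation A :: real where "A \<equiv> nl_bound s p R"

abbreviation L :: real where "L \<equiv> nl_lip s p R"

abbreviation Q :: real where "Q \<equiv> nl_lip' s p R"

definition g :: "real \<Rightarrow> int \<Rightarrow> complex" where
  "g t = nonlin K p (y t)"

definition g' :: "real \<Rightarrow> int \<Rightarrow> complex" where
  "g' t = nonlin_deriv K (p - 1) (y t) (y' t)"

lemma y_le: "t \<in> I \<Longrightarrow> snorm K (s + 1) (y t) \<le> R"
  using bound[of t] snorm_nonneg[of K s "y' t"] by linarith

lemma y'_le: "t \<in> I \<Longrightarrow> snorm K s (y' t) \<le> R"
  using bound[of t] snorm_nonneg[of K "s + 1" "y t"] by linarith

lemma R_nonneg: "t \<in> I \<Longrightarrow> 0 \<le> R"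
  using y_le[of t] snorm_nonneg[of K "s + 1" "y t"] by linarith

lemma y_deriv: "t \<in> I \<Longrightarrow> j \<in> idx K \<Longrightarrow> ((\<lambda>\<tau>. y \<tau> j) has_vector_derivative y' t j) (at t within I)"
  using solution by (simp add: semidiscrete_solution_def)

lemma y'_deriv: "t \<in> I \<Longrightarrow> j \<in> idx K \<Longrightarrow>
    ((\<lambda>\<tau>. y' \<tau> j) has_vector_derivative - ((omega j)\<^sup>2 *\<^sub>R y t j) + g t j) (at t within I)"
  using solution by (simp add: semidiscrete_solution_def g_def)

lemma g_deriv:
  assumes "t \<in> I" "j \<in> idx K"
  shows "((\<lambda>\<tau>. g \<tau> j) has_vector_derivative g' t j) (at t within I)"
proof -
  have "((\<lambda>\<tau>. nonlin K (Suc (p - 1)) (y \<tau>) j) has_vector_derivative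
      nonlin_deriv K (p - 1) (y t) (y' t) j) (at t within I)"
    by (intro nonlin_has_vector_derivative K y_deriv assms)
  then show ?thesis using p by (simp add: g_def g'_def)
qed

lemma g_le: "t \<in> I \<Longrightarrow> snorm K (s + 1) (g t) \<le> A"
  unfolding g_def by (intro snorm_nonlin_bound K p s y_le)

lemma lipschitz_of_deriv:
  fixes \<phi> :: "real \<Rightarrow> int \<Rightarrow> complex"
  assumes a: "a \<in> I" and b: "b \<in> I"
    and deriv: "\<And>t j. t \<in> I \<Longrightarrow> j \<in> idx K \<Longrightarrow> ((\<lambda>\<tau>. \<phi> \<tau> j) has_vector_derivative \<phi>' t j) (at t within I)"
    and le: "\<And>t. t \<in> I \<Longrightarrow> snorm K \<sigma> (\<phi>' t) \<le> B"
  shows "snorm K \<sigma> (\<lambda>j. \<phi> b j - \<phi> a j) \<le> B * \<bar>b - a\<bar>"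
proof -
  have *: "snorm K \<sigma> (\<lambda>j. \<phi> d j - \<phi> c j) \<le> B * (d - c)" if "c \<in> I" "d \<in> I" "c \<le> d" for c d
  proof (rule snorm_mean_value[OF \<open>c \<le> d\<close>])
    fix t assume t: "t \<in> {c..d}"
    then have "t \<in> I" using that by auto
    then show "snorm K \<sigma> (\<phi>' t) \<le> B" by (rule le)
    fix j assume "j \<in> idx K"
    then show "((\<lambda>\<tau>. \<phi> \<tau> j) has_vector_derivative \<phi>' t j) (at t within {c..d})"
      using \<open>t \<in> I\<close> that by (intro has_vector_derivative_within_subset[OF deriv]) auto
  qed
  show ?thesis
  proof (cases "a \<le> b")
    case True
    then show ?thesis using *[OF a b] by simp
  next
    case False
    then show ?thesis using *[OF b a] by (simp add: snorm_diff_commute[of K \<sigma> "\<phi> b"])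
  qed
qed

lemma y_lip:
  "a \<in> I \<Longrightarrow> b \<in> I \<Longrightarrow> snorm K s (\<lambda>j. y b j - y a j) \<le> R * \<bar>b - a\<bar>"
  by (rule lipschitz_of_deriv[OF _ _ y_deriv y'_le])

text \<open>
The second derivative \<open>- \<Omega>\<^sup>2 y + f(y)\<close> loses two derivatives of \<open>y\<close>, hence the order \<open>s - 1\<close>.
\<close>

lemma y'_lip:
  assumes "a \<in> I" "b \<in> I"
  shows "snorm K (s - 1) (\<lambda>j. y' b j - y' a j) \<le> (R + A) * \<bar>b - a\<bar>"
proof (rule lipschitz_of_deriv[OF assms y'_deriv])
  fix t assume t: "t \<in> I"
  have "snorm K (s - 1) (\<lambda>j. (- ((omega j)\<^sup>2)) *\<^sub>R y t j) \<le> 1 * snorm K (s + 1) (y t)"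
  proof (rule snorm_multiplier)
    fix j
    have "(omega j)\<^sup>2 \<le> (jap j)\<^sup>2"
      by (intro power_mono omega_le_jap omega_nonneg)
    then show "\<bar>- ((omega j)\<^sup>2)\<bar> \<le> 1 * jap j powr (s + 1 - (s - 1))"
      using jap_pos[of j] by simp
  qed simp
  moreover have "snorm K (s - 1) (g t) \<le> snorm K (s + 1) (g t)"
    by (rule snorm_mono_index) simp
  moreover have "snorm K (s - 1) (\<lambda>j. - ((omega j)\<^sup>2 *\<^sub>R y t j) + g t j)
      \<le> snorm K (s - 1) (\<lambda>j. (- ((omega j)\<^sup>2)) *\<^sub>R y t j) + snorm K (s - 1) (g t)"
    using snorm_triangle[of K "s - 1" "\<lambda>j. (- ((omega j)\<^sup>2)) *\<^sub>R y t j"] by simp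
  ultimately show "snorm K (s - 1) (\<lambda>j. - ((omega j)\<^sup>2 *\<^sub>R y t j) + g t j) \<le> R + A"
    using y_le[OF t] g_le[OF t] by linarith
qed

lemma g_lip:
  assumes "a \<in> I" "b \<in> I"
  shows "snorm K s (\<lambda>j. g b j - g a j) \<le> L * (R * \<bar>b - a\<bar>)"
proof -
  have "snorm K s (\<lambda>j. g b j - g a j) \<le> L * snorm K s (\<lambda>j. y b j - y a j)"
    unfolding g_def using assms by (intro snorm_nonlin_lip K p s y_le) auto
  also have "\<dots> \<le> L * (R * \<bar>b - a\<bar>)"
    using assms R_nonneg by (intro mult_left_mono y_lip nl_consts_nonneg) auto
  finally show ?thesis .
qed

lemma g'_lip:
  assumes "a \<in> I" "b \<in> I"
  shows "snorm K (s - 1) (\<lambda>j. g' b j - g' a j) \<le> Q * ((2 * R + A) * \<bar>b - a\<bar>)"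
proof -
  have "snorm K (s - 1) (\<lambda>j. g' b j - g' a j)
      \<le> Q * (snorm K (s - 1) (\<lambda>j. y' b j - y' a j) + snorm K s (\<lambda>j. y b j - y a j))"
    using snorm_nonlin_deriv_diff_le[OF K s y_le[OF assms(2)] y_le[OF assms(1)]
        y'_le[OF assms(2)] y'_le[OF assms(1)], of "p - 1"] p
    by (simp add: g'_def nl_lip'_def)
  also have "\<dots> \<le> Q * ((R + A) * \<bar>b - a\<bar> + R * \<bar>b - a\<bar>)"
    using assms R_nonneg by (intro mult_left_mono add_mono y_lip y'_lip nl_consts_nonneg) auto
  finally show ?thesis by (simp add: algebra_simps)
qed

text \<open>
A second difference controls the error of the midpoint rule.  The second derivative of \<open>g\<close> is not
formed; a Lipschitz bound for \<open>g'\<close> is enough.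
\<close>

lemma g_second_difference:
  assumes u: "0 \<le> u" "m - u \<in> I" "m + u \<in> I"
  shows "snorm K (s - 1) (\<lambda>j. g (m + u) j + g (m - u) j - 2 *\<^sub>R g m j) \<le> Q * ((2 * R + A) * (2 * u)) * u"
proof -
  have in_I: "m + v \<in> I" "m - v \<in> I" if "v \<in> {0..u}" for v
    using that u by auto
  have nonneg: "0 \<le> Q * (2 * R + A)"
    using R_nonneg[OF u(3)] nl_consts_nonneg[of R] by simp
  have "snorm K (s - 1) (\<lambda>j. (g (m + u) j + g (m - u) j) - (g (m + 0) j + g (m - 0) j))
      \<le> Q * ((2 * R + A) * (2 * u)) * (u - 0)"
  proof (rule snorm_mean_value[OF u(1)])
    fix v assume v: "v \<in> {0..u}"
    have "snorm K (s - 1) (\<lambda>j. g' (m + v) j - g' (m - v) j) \<le> Q * ((2 * R + A) * \<bar>(m + v) - (m - v)\<bar>)"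
      using in_I v by (intro g'_lip) auto
    also have "\<dots> = Q * (2 * R + A) * (2 * v)" using v by simp
    also have "\<dots> \<le> Q * (2 * R + A) * (2 * u)"
      using v nonneg by (intro mult_left_mono) auto
    finally show "snorm K (s - 1) (\<lambda>j. g' (m + v) j - g' (m - v) j) \<le> Q * ((2 * R + A) * (2 * u))"
      by simp
    fix j assume j: "j \<in> idx K"
    have "((\<lambda>\<tau>. g (m + 1 * \<tau>) j) has_vector_derivative 1 *\<^sub>R g' (m + 1 * v) j) (at v within {0..u})"
      "((\<lambda>\<tau>. g (m + (-1) * \<tau>) j) has_vector_derivative (-1) *\<^sub>R g' (m + (-1) * v) j) (at v within {0..u})"
      using in_I j v by (intro has_vector_derivative_affine[where S = I] g_deriv; simp)+
    from has_vector_derivative_add[OF this]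
    show "((\<lambda>\<tau>. g (m + \<tau>) j + g (m - \<tau>) j) has_vector_derivative g' (m + v) j - g' (m - v) j)
        (at v within {0..u})" by simp
  qed
  then show ?thesis by (simp add: scaleR_2 algebra_simps)
qed

text \<open>
Variation of constants: \<open>flow_pos t d \<tau>\<close> and \<open>flow_vel t d \<tau>\<close> are the components of the linear flow over
the remaining time \<open>d - \<tau>\<close>, applied to the exact solution at time \<open>t + \<tau>\<close>.  They lead from the linear
propagation of the data at \<open>t\<close> to the exact solution at \<open>t + d\<close>, and in their derivatives only the
nonlinearity survives.
\<close>

definition flow_pos :: "real \<Rightarrow> real \<Rightarrow> real \<Rightarrow> int \<Rightarrow> complex" where
  "flow_pos t d \<tau> j = cos ((d - \<tau>) * omega j) *\<^sub>R y (t + \<tau>) j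
     + cos_integral (d - \<tau>) (omega j) *\<^sub>R y' (t + \<tau>) j"

definition flow_vel :: "real \<Rightarrow> real \<Rightarrow> real \<Rightarrow> int \<Rightarrow> complex" where
  "flow_vel t d \<tau> j = - ((omega j * sin ((d - \<tau>) * omega j)) *\<^sub>R y (t + \<tau>) j)
     + cos ((d - \<tau>) * omega j) *\<^sub>R y' (t + \<tau>) j"

lemma flow_pos_end: "flow_pos t d d j = y (t + d) j"
  by (simp add: flow_pos_def cos_integral_def)

lemma flow_vel_end: "flow_vel t d d j = y' (t + d) j"
  by (simp add: flow_vel_def)

lemma shifted_deriv:
  assumes "\<tau> \<in> U" "\<And>\<tau>. \<tau> \<in> U \<Longrightarrow> t + \<tau> \<in> I" "j \<in> idx K"
  shows "((\<lambda>\<tau>. y (t + \<tau>) j) has_vector_derivative y' (t + \<tau>) j) (at \<tau> within U)"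
    and "((\<lambda>\<tau>. y' (t + \<tau>) j) has_vector_derivative - ((omega j)\<^sup>2 *\<^sub>R y (t + \<tau>) j) + g (t + \<tau>) j)
      (at \<tau> within U)"
  using has_vector_derivative_affine[of "\<lambda>\<tau>. y \<tau> j" _ t 1 \<tau> I U, OF y_deriv]
    has_vector_derivative_affine[of "\<lambda>\<tau>. y' \<tau> j" _ t 1 \<tau> I U, OF y'_deriv] assms
  by simp_all

lemma flow_pos_deriv:
  assumes "\<tau> \<in> U" "\<And>\<tau>. \<tau> \<in> U \<Longrightarrow> t + \<tau> \<in> I" "j \<in> idx K"
  shows "((\<lambda>\<tau>. flow_pos t d \<tau> j) has_vector_derivative
    cos_integral (d - \<tau>) (omega j) *\<^sub>R g (t + \<tau>) j) (at \<tau> within U)"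
proof -
  let ?w = "omega j" and ?u = "d - \<tau>"
  have "?w * sin (?u * ?w) = ?w\<^sup>2 * cos_integral ?u ?w"
    by (simp add: cos_integral_def power2_eq_square)
  then have "cos (?u * ?w) *\<^sub>R y' (t + \<tau>) j + (?w * sin (?u * ?w)) *\<^sub>R y (t + \<tau>) j
      + (cos_integral ?u ?w *\<^sub>R (- (?w\<^sup>2 *\<^sub>R y (t + \<tau>) j) + g (t + \<tau>) j)
        + (- cos (?u * ?w)) *\<^sub>R y' (t + \<tau>) j)
    = cos_integral ?u ?w *\<^sub>R g (t + \<tau>) j"
    by (simp add: algebra_simps)
  then show ?thesis
    unfolding flow_pos_def
    using has_vector_derivative_add[OF
      has_vector_derivative_scaleR[OF has_derivative_cos_reversed shifted_deriv(1)[OF assms]]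
      has_vector_derivative_scaleR[OF has_derivative_cos_integral_reversed shifted_deriv(2)[OF assms]],
      of d ?w d ?w] by metis
qed

lemma flow_vel_deriv:
  assumes "\<tau> \<in> U" "\<And>\<tau>. \<tau> \<in> U \<Longrightarrow> t + \<tau> \<in> I" "j \<in> idx K"
  shows "((\<lambda>\<tau>. flow_vel t d \<tau> j) has_vector_derivative
    cos ((d - \<tau>) * omega j) *\<^sub>R g (t + \<tau>) j) (at \<tau> within U)"
proof -
  let ?w = "omega j" and ?u = "d - \<tau>"
  have d: "((\<lambda>\<tau>. - (?w * sin ((d - \<tau>) * ?w))) has_field_derivative ?w\<^sup>2 * cos (?u * ?w)) (at \<tau> within U)"
    by (auto intro!: derivative_eq_intros simp: power2_eq_square)
  have "(- (?w * sin (?u * ?w))) *\<^sub>R y' (t + \<tau>) j + (?w\<^sup>2 * cos (?u * ?w)) *\<^sub>R y (t + \<tau>) j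
      + (cos (?u * ?w) *\<^sub>R (- (?w\<^sup>2 *\<^sub>R y (t + \<tau>) j) + g (t + \<tau>) j)
        + (?w * sin (?u * ?w)) *\<^sub>R y' (t + \<tau>) j)
    = cos (?u * ?w) *\<^sub>R g (t + \<tau>) j"
    by (simp add: algebra_simps)
  then show ?thesis
    unfolding flow_vel_def
    using has_vector_derivative_add[OF
      has_vector_derivative_scaleR[OF d shifted_deriv(1)[OF assms]]
      has_vector_derivative_scaleR[OF has_derivative_cos_reversed shifted_deriv(2)[OF assms]],
      of d ?w] by (metis (no_types, lifting) ext scaleR_minus_left)
qed

end

section \<open>Local error\<close>

lemma erkn_step_eq:
  "fst (erkn_step K p h bb b (u, u')) j = cos (h * omega j) *\<^sub>R u j + cos_integral h (omega j) *\<^sub>R u' j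
     + (h\<^sup>2 * bb (h\<^sup>2 * (omega j)\<^sup>2)) *\<^sub>R nonlin K p (erkn_mid h u u') j"
  "snd (erkn_step K p h bb b (u, u')) j = - ((omega j * sin (h * omega j)) *\<^sub>R u j)
     + cos (h * omega j) *\<^sub>R u' j
     + (h * b (h\<^sup>2 * (omega j)\<^sup>2)) *\<^sub>R nonlin K p (erkn_mid h u u') j"
  by (auto simp: erkn_step_def cos_integral_def)

text \<open>
The sum of the constants of \<open>local_error_pos\<close> and \<open>local_error_vel\<close>.
\<close>

definition local_const :: "real \<Rightarrow> nat \<Rightarrow> real \<Rightarrow> real \<Rightarrow> real" where
  "local_const s p R c = (2 * nl_bound s p R + nl_lip s p R * (R + nl_bound s p R) + (c + 2) * nl_bound s p R)
    + (8 * nl_bound s p R + 2 * nl_lip' s p R * (2 * R + nl_bound s p R)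
      + nl_lip s p R * nl_bound s p R + c * nl_bound s p R)"

lemma mult_powr_cancel:
  fixes h x :: real
  assumes "0 < h" "0 < x"
  shows "a * (h * x) powr \<beta> = (a * h powr \<beta>) * x powr \<beta>"
  using assms by (simp add: powr_mult)

context bounded_solution
begin

lemma erkn_mid_error:
  assumes t: "t \<in> I" "t + h \<in> I" and h: "0 < h" "h \<le> 1"
  shows "snorm K (s + 1) (\<lambda>j. y (t + h / 2) j - erkn_mid h (y t) (y' t) j) \<le> h\<^sup>2 * A"
proof -
  have A: "0 \<le> A" using R_nonneg t nl_consts_nonneg by blast
  have in_I: "t + \<tau> \<in> I" if "\<tau> \<in> {0..h / 2}" for \<tau>
    using that t h by auto
  have "snorm K (s + 1) (\<lambda>j. flow_pos t (h / 2) (h / 2) j - flow_pos t (h / 2) 0 j)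
      \<le> (h * A) * (h / 2 - 0)"
  proof (rule snorm_mean_value)
    fix \<tau> assume \<tau>: "\<tau> \<in> {0..h / 2}"
    have "snorm K (s + 1) (\<lambda>j. cos_integral (h / 2 - \<tau>) (omega j) *\<^sub>R g (t + \<tau>) j)
        \<le> h * snorm K (s + 1) (g (t + \<tau>))"
    proof (rule snorm_multiplier)
      fix j
      have "\<bar>cos_integral (h / 2 - \<tau>) (omega j)\<bar> \<le> h / 2 - \<tau>"
        using \<tau> by (intro abs_cos_integral_le) auto
      then show "\<bar>cos_integral (h / 2 - \<tau>) (omega j)\<bar> \<le> h * jap j powr (s + 1 - (s + 1))"
        using \<tau> h jap_pos[of j] by simp
    qed (use h in simp)
    also have "\<dots> \<le> h * A"
      using h \<tau> by (intro mult_left_mono g_le in_I) auto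
    finally show "snorm K (s + 1) (\<lambda>j. cos_integral (h / 2 - \<tau>) (omega j) *\<^sub>R g (t + \<tau>) j) \<le> h * A" .
    fix j assume "j \<in> idx K"
    then show "((\<lambda>\<tau>. flow_pos t (h / 2) \<tau> j) has_vector_derivative
        cos_integral (h / 2 - \<tau>) (omega j) *\<^sub>R g (t + \<tau>) j) (at \<tau> within {0..h / 2})"
      using \<tau> in_I by (intro flow_pos_deriv)
  qed (use h in simp)
  also have "\<dots> \<le> h\<^sup>2 * A"
    using h A by (simp add: power2_eq_square)
  finally show ?thesis
    unfolding flow_pos_end by (simp add: flow_pos_def erkn_mid_eq)
qed

lemma erkn_mid_le:
  assumes "t \<in> I" "0 < h" "h \<le> 1"
  shows "snorm K (s + 1) (erkn_mid h (y t) (y' t)) \<le> R"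
  using snorm_erkn_mid_le[of h K s "y t" "y' t"] bound[OF assms(1)] assms by linarith

lemma nonlin_mid_error:
  assumes t: "t \<in> I" "t + h \<in> I" and h: "0 < h" "h \<le> 1" and \<sigma>: "\<sigma> \<le> s + 1"
  shows "snorm K \<sigma> (\<lambda>j. g (t + h / 2) j - nonlin K p (erkn_mid h (y t) (y' t)) j) \<le> L * (h\<^sup>2 * A)"
proof -
  have m: "t + h / 2 \<in> I" using t h by auto
  have "snorm K \<sigma> (\<lambda>j. g (t + h / 2) j - nonlin K p (erkn_mid h (y t) (y' t)) j)
      \<le> snorm K (s + 1) (\<lambda>j. g (t + h / 2) j - nonlin K p (erkn_mid h (y t) (y' t)) j)"
    using \<sigma> by (rule snorm_mono_index)
  also have "\<dots> \<le> L * snorm K (s + 1) (\<lambda>j. y (t + h / 2) j - erkn_mid h (y t) (y' t) j)"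
    unfolding g_def using m t h by (intro snorm_nonlin_lip K p s y_le erkn_mid_le) auto
  also have "\<dots> \<le> L * (h\<^sup>2 * A)"
    using R_nonneg[OF m] t h by (intro mult_left_mono erkn_mid_error nl_consts_nonneg)
  finally show ?thesis .
qed

lemma nonlin_mid_le:
  assumes "t \<in> I" "0 < h" "h \<le> 1"
  shows "snorm K (s + 1) (nonlin K p (erkn_mid h (y t) (y' t))) \<le> A"
  using assms by (intro snorm_nonlin_bound K p s erkn_mid_le)

text \<open>
The numerical method replaces \<open>f(y(t + \<tau>))\<close> by the constant vector \<open>F\<close> and the weight by \<open>bb\<close>.  The
auxiliary curve \<open>\<psi>\<close> differs from \<open>flow_pos\<close> by the exactly integrated \<open>F\<close>, so that its derivative
contains only \<open>f(y(t + \<tau>)) - F\<close>; this is bounded in the norm of order \<open>s + 1\<close> and \<open>O(h)\<close> in the norm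
of order \<open>s\<close>, and interpolation gives the rest.  The weights contribute their defect in Condition
\<open>A(\<alpha>)\<close>.
\<close>

lemma local_error_pos:
  assumes t: "t \<in> I" "t + h \<in> I" and h: "0 < h" "h \<le> 1" and \<alpha>: "-1 \<le> \<alpha>" "\<alpha> \<le> 1" and c: "1 \<le> c"
    and cond: "condA K h bb b c \<alpha>" "condA_zero bb b c \<alpha>" "condA_zero bb b c 0"
  shows "snorm K (s + 1 - \<alpha>) (\<lambda>j. y (t + h) j - fst (erkn_step K p h bb b (y t, y' t)) j)
    \<le> (2 * A + L * (R + A) + (c + 2) * A) * (h\<^sup>2 * h powr \<alpha>)"
proof -
  define F where "F = nonlin K p (erkn_mid h (y t) (y' t))"
  define H where "H = h powr \<alpha>"
  have H: "0 < H" using h by (simp add: H_def)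
  have R: "0 \<le> R" using R_nonneg t by blast
  note nonneg = nl_consts_nonneg[OF R, of s p]
  have in_I: "t + \<tau> \<in> I" if "\<tau> \<in> {0..h}" for \<tau>
    using that t h by auto
  have F_le: "snorm K (s + 1) F \<le> A"
    unfolding F_def using t h by (intro nonlin_mid_le)
  have diff_hi: "snorm K (s + 1) (\<lambda>j. g (t + \<tau>) j - F j) \<le> 2 * A" if "\<tau> \<in> {0..h}" for \<tau>
    using snorm_diff[of K "s + 1" "g (t + \<tau>)" F] g_le[OF in_I[OF that]] F_le by linarith
  \<comment> \<open>Lipschitz continuity in time up to the midpoint, then the error of the internal stage.\<close>
  have diff_lo: "snorm K s (\<lambda>j. g (t + \<tau>) j - F j) \<le> L * (R + A) * h" if "\<tau> \<in> {0..h}" for \<tau>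
  proof -
    have m: "t + h / 2 \<in> I" using t h by auto
    have "snorm K s (\<lambda>j. g (t + \<tau>) j - F j)
        = snorm K s (\<lambda>j. (g (t + \<tau>) j - g (t + h / 2) j) + (g (t + h / 2) j - F j))" by simp
    also have "\<dots> \<le> snorm K s (\<lambda>j. g (t + \<tau>) j - g (t + h / 2) j) + snorm K s (\<lambda>j. g (t + h / 2) j - F j)"
      by (rule snorm_triangle)
    also have "\<dots> \<le> L * (R * \<bar>(t + \<tau>) - (t + h / 2)\<bar>) + L * (h\<^sup>2 * A)"
      unfolding F_def by (intro add_mono g_lip nonlin_mid_error) (use m t h in_I that in auto)
    also have "\<dots> \<le> L * (R * h) + L * (h * A)"
    proof -
      have "\<bar>(t + \<tau>) - (t + h / 2)\<bar> \<le> h" using that by (auto simp: abs_if)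
      moreover have "h\<^sup>2 \<le> h" using h by (simp add: power2_eq_square mult_left_le)
      ultimately show ?thesis
        using nonneg R by (intro add_mono mult_left_mono mult_right_mono) auto
    qed
    finally show ?thesis by (simp add: algebra_simps)
  qed
  define \<psi> where "\<psi> \<tau> j = flow_pos t h \<tau> j + cos_integral2 (h - \<tau>) (omega j) *\<^sub>R F j" for \<tau> j
  have "snorm K (s + 1 - \<alpha>) (\<lambda>j. \<psi> h j - \<psi> 0 j) \<le> (H * (h * (2 * A + L * (R + A)))) * (h - 0)"
  proof (rule snorm_mean_value)
    fix \<tau> assume \<tau>: "\<tau> \<in> {0..h}"
    let ?d = "\<lambda>j. g (t + \<tau>) j - F j"
    let ?x = "\<lambda>j. cos_integral (h - \<tau>) (omega j) *\<^sub>R ?d j"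
    have hi: "snorm K (s + 1 + 1) ?x \<le> 1 * snorm K (s + 1) ?d"
    proof (rule snorm_multiplier)
      fix j
      have "\<bar>cos_integral (h - \<tau>) (omega j)\<bar> \<le> 1 / jap j"
        using \<tau> h by (intro abs_cos_integral_jap_le) auto
      also have "\<dots> = 1 * jap j powr (s + 1 - (s + 1 + 1))"
        using jap_pos[of j] by (simp add: powr_minus divide_inverse)
      finally show "\<bar>cos_integral (h - \<tau>) (omega j)\<bar> \<le> 1 * jap j powr (s + 1 - (s + 1 + 1))" .
    qed simp
    have lo: "snorm K (s + 1 - 1) ?x \<le> h * snorm K s ?d"
    proof (rule snorm_multiplier)
      fix j
      have "\<bar>cos_integral (h - \<tau>) (omega j)\<bar> \<le> h - \<tau>"
        using \<tau> by (intro abs_cos_integral_le) auto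
      then show "\<bar>cos_integral (h - \<tau>) (omega j)\<bar> \<le> h * jap j powr (s - (s + 1 - 1))"
        using \<tau> jap_pos[of j] by simp
    qed (use h in simp)
    have "snorm K (s + 1 - \<alpha>) ?x \<le> H * (h * snorm K (s + 1 + 1) ?x + 1 / h * snorm K (s + 1 - 1) ?x)"
      unfolding H_def by (rule snorm_interpolation[OF h(1) \<alpha>])
    also have "\<dots> \<le> H * (h * (2 * A) + 1 / h * (h * (L * (R + A) * h)))"
    proof -
      have "snorm K (s + 1 + 1) ?x \<le> 2 * A"
        using hi diff_hi[OF \<tau>] by linarith
      moreover have "snorm K (s + 1 - 1) ?x \<le> h * (L * (R + A) * h)"
        using lo mult_left_mono[OF diff_lo[OF \<tau>], of h] h by linarith
      ultimately show ?thesis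
        using h H by (intro mult_left_mono add_mono) auto
    qed
    also have "\<dots> = H * (h * (2 * A + L * (R + A)))"
      using h by (simp add: algebra_simps)
    finally show "snorm K (s + 1 - \<alpha>) ?x \<le> H * (h * (2 * A + L * (R + A)))" .
    fix j assume j: "j \<in> idx K"
    have "((\<lambda>\<tau>. cos_integral2 (h - \<tau>) (omega j) *\<^sub>R F j) has_vector_derivative
        cos_integral2 (h - \<tau>) (omega j) *\<^sub>R 0 + (- cos_integral (h - \<tau>) (omega j)) *\<^sub>R F j)
        (at \<tau> within {0..h})"
      by (rule has_vector_derivative_scaleR[OF has_derivative_cos_integral2_reversed has_vector_derivative_const])
    from has_vector_derivative_add[OF flow_pos_deriv[OF \<tau> in_I j] this]
    show "((\<lambda>\<tau>. \<psi> \<tau> j) has_vector_derivative ?x j) (at \<tau> within {0..h})"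
      by (simp add: \<psi>_def scaleR_diff_right)
  qed (use h in simp)
  moreover have "snorm K (s + 1 - \<alpha>) (\<lambda>j. (h\<^sup>2 * ((sinc (h * omega j / 2))\<^sup>2 / 2 - bb (h\<^sup>2 * (omega j)\<^sup>2))) *\<^sub>R F j)
      \<le> (h\<^sup>2 * ((c + 2) * H)) * snorm K (s + 1) F"
  proof (rule snorm_multiplier)
    fix j assume "j \<in> idx K"
    from condA_defect(3)[OF cond \<alpha> c h this]
    have "\<bar>(sinc (h * omega j / 2))\<^sup>2 / 2 - bb (h\<^sup>2 * (omega j)\<^sup>2)\<bar> \<le> ((c + 2) * H) * jap j powr \<alpha>"
      unfolding mult_powr_cancel[OF h(1) jap_pos] H_def .
    from mult_left_mono[OF this, of "h\<^sup>2"]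
    show "\<bar>h\<^sup>2 * ((sinc (h * omega j / 2))\<^sup>2 / 2 - bb (h\<^sup>2 * (omega j)\<^sup>2))\<bar>
        \<le> (h\<^sup>2 * ((c + 2) * H)) * jap j powr (s + 1 - (s + 1 - \<alpha>))"
      unfolding abs_mult by (simp add: mult.assoc)
  qed (use h c H in simp)
  moreover have "(h\<^sup>2 * ((c + 2) * H)) * snorm K (s + 1) F \<le> (h\<^sup>2 * ((c + 2) * H)) * A"
    using F_le c H by (intro mult_left_mono) auto
  moreover have "y (t + h) j - fst (erkn_step K p h bb b (y t, y' t)) j
      = (\<psi> h j - \<psi> 0 j) + (h\<^sup>2 * ((sinc (h * omega j / 2))\<^sup>2 / 2 - bb (h\<^sup>2 * (omega j)\<^sup>2))) *\<^sub>R F j" for j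
  proof -
    have "\<psi> h j = y (t + h) j"
      unfolding \<psi>_def flow_pos_end by (simp add: cos_integral2_def)
    moreover have "\<psi> 0 j = cos (h * omega j) *\<^sub>R y t j + cos_integral h (omega j) *\<^sub>R y' t j
        + (h\<^sup>2 * ((sinc (h * omega j / 2))\<^sup>2 / 2)) *\<^sub>R F j"
      unfolding \<psi>_def flow_pos_def cos_integral2_eq_sinc[symmetric] by simp
    ultimately show ?thesis
      unfolding erkn_step_eq F_def[symmetric] right_diff_distrib[of "h\<^sup>2"] scaleR_diff_left by simp
  qed
  ultimately have "snorm K (s + 1 - \<alpha>) (\<lambda>j. y (t + h) j - fst (erkn_step K p h bb b (y t, y' t)) j)
      \<le> (H * (h * (2 * A + L * (R + A)))) * (h - 0) + (h\<^sup>2 * ((c + 2) * H)) * A"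
    by (simp only:) (rule order_trans[OF snorm_triangle], linarith)
  then show ?thesis
    unfolding H_def by (simp add: power2_eq_square algebra_simps)
qed

text \<open>
For \<open>\<alpha> = 1\<close> the local error has to reach third order in the norm of order \<open>s - 1\<close>, so that the symmetry of the
midpoint must be used.  The curve \<open>\<psi>\<close> is therefore the central difference of \<open>flow_vel\<close> about the
midpoint \<open>m\<close> minus its midpoint approximation.  Its derivative consists of the second difference of
\<open>g\<close> and of two terms \<open>(1 - cos) g\<close>, which are small because \<open>1 - cos x\<close> is bounded by a multiple of
\<open>x powr (1 + \<alpha>)\<close>.
\<close>

lemma local_error_vel:
  assumes t: "t \<in> I" "t + h \<in> I" and h: "0 < h" "h \<le> 1" and \<alpha>: "-1 \<le> \<alpha>" "\<alpha> \<le> 1" and c: "1 \<le> c"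
    and cond: "condA K h bb b c \<alpha>" "condA_zero bb b c \<alpha>" "condA_zero bb b c 0"
  shows "snorm K (s - \<alpha>) (\<lambda>j. y' (t + h) j - snd (erkn_step K p h bb b (y t, y' t)) j)
    \<le> (8 * A + 2 * Q * (2 * R + A) + L * A + c * A) * (h\<^sup>2 * h powr \<alpha>)"
proof -
  define F where "F = nonlin K p (erkn_mid h (y t) (y' t))"
  define H where "H = h powr \<alpha>"
  define m where "m = t + h / 2"
  have H: "0 < H" using h by (simp add: H_def)
  have hH: "h \<le> H" using powr_mono'[of \<alpha> 1 h] h \<alpha> by (simp add: H_def)
  have R: "0 \<le> R" using R_nonneg t by blast
  note nonneg = nl_consts_nonneg[OF R, of s p]
  have m: "m \<in> I" using t h by (auto simp: m_def)
  have in_I: "m + u \<in> I" "m - u \<in> I" if "u \<in> {0..h / 2}" for u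
    using that t h by (auto simp: m_def)
  have F_le: "snorm K (s + 1) F \<le> A"
    unfolding F_def using t h by (intro nonlin_mid_le)
  define \<psi> where "\<psi> u j = (flow_vel t h (h / 2 + u) j - flow_vel t h (h / 2 - u) j) - (2 * u) *\<^sub>R g m j"
    for u j
  \<comment> \<open>Replacing the cosine by \<open>1\<close> costs \<open>1 + \<alpha>\<close> derivatives, which lead from order \<open>s - \<alpha>\<close> to \<open>s + 1\<close>.\<close>
  have cos_defect: "snorm K (s - \<alpha>) (\<lambda>j. (1 - cos (v * omega j)) *\<^sub>R g \<tau> j) \<le> 2 * (h * H) * A"
    if v: "0 \<le> v" "v \<le> h" and \<tau>: "\<tau> \<in> I" for v \<tau>
  proof -
    have "snorm K (s - \<alpha>) (\<lambda>j. (1 - cos (v * omega j)) *\<^sub>R g \<tau> j) \<le> 2 * (h * H) * snorm K (s + 1) (g \<tau>)"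
    proof (rule snorm_multiplier)
      fix j
      have "1 - cos (v * omega j) \<le> 2 * (h * jap j) powr (1 + \<alpha>)"
        using v h \<alpha> omega_nonneg[of j] omega_le_jap[of j] jap_pos[of j]
        by (intro one_minus_cos_le_powr mult_mono) auto
      also have "\<dots> = 2 * (h * H) * jap j powr (s + 1 - (s - \<alpha>))"
        unfolding mult_powr_cancel[OF h(1) jap_pos] H_def using h by (simp add: powr_add)
      finally show "\<bar>1 - cos (v * omega j)\<bar> \<le> 2 * (h * H) * jap j powr (s + 1 - (s - \<alpha>))"
        by simp
    qed (use h H in simp)
    also have "\<dots> \<le> 2 * (h * H) * A"
      using h H \<tau> by (intro mult_left_mono g_le) auto
    finally show ?thesis .
  qed
  have "snorm K (s - \<alpha>) (\<lambda>j. \<psi> (h / 2) j - \<psi> 0 j)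
      \<le> (H * (h * (8 * A + 2 * Q * (2 * R + A)))) * (h / 2 - 0)"
  proof (rule snorm_mean_value)
    fix u assume u: "u \<in> {0..h / 2}"
    let ?x = "\<lambda>j. g (m + u) j + g (m - u) j - 2 *\<^sub>R g m j"
    let ?p = "\<lambda>j. (1 - cos ((h / 2 - u) * omega j)) *\<^sub>R g (m + u) j"
    let ?q = "\<lambda>j. (1 - cos ((h / 2 + u) * omega j)) *\<^sub>R g (m - u) j"
    have "snorm K (s - \<alpha>) ?x \<le> H * (h * snorm K (s + 1) ?x + 1 / h * snorm K (s - 1) ?x)"
      unfolding H_def by (rule snorm_interpolation[OF h(1) \<alpha>])
    also have "\<dots> \<le> H * (h * (4 * A) + 1 / h * (2 * Q * (2 * R + A) * h\<^sup>2))"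
    proof -
      have "snorm K (s + 1) ?x \<le> (snorm K (s + 1) (g (m + u)) + snorm K (s + 1) (g (m - u)))
          + snorm K (s + 1) (\<lambda>j. 2 *\<^sub>R g m j)"
        by (intro order_trans[OF snorm_diff] add_mono snorm_triangle order_refl)
      also have "\<dots> \<le> (A + A) + 2 * A"
        unfolding snorm_scaleR by (intro add_mono g_le in_I u) (use g_le[OF m] in simp)
      finally have hi: "snorm K (s + 1) ?x \<le> 4 * A" by simp
      have "snorm K (s - 1) ?x \<le> Q * ((2 * R + A) * (2 * u)) * u"
        using u in_I by (intro g_second_difference) auto
      also have "\<dots> = 2 * Q * (2 * R + A) * u\<^sup>2" by (simp add: power2_eq_square)
      also have "\<dots> \<le> 2 * Q * (2 * R + A) * h\<^sup>2"
        using u h nonneg R by (intro mult_left_mono power_mono) auto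
      finally have lo: "snorm K (s - 1) ?x \<le> 2 * Q * (2 * R + A) * h\<^sup>2" .
      show ?thesis using h H hi lo by (intro mult_left_mono add_mono) auto
    qed
    also have "\<dots> = H * (h * (4 * A + 2 * Q * (2 * R + A)))"
      using h by (simp add: power2_eq_square algebra_simps)
    finally have x: "snorm K (s - \<alpha>) ?x \<le> H * (h * (4 * A + 2 * Q * (2 * R + A)))" .
    have "snorm K (s - \<alpha>) (\<lambda>j. ?x j - (?p j + ?q j))
        \<le> snorm K (s - \<alpha>) ?x + (snorm K (s - \<alpha>) ?p + snorm K (s - \<alpha>) ?q)"
      by (intro order_trans[OF snorm_diff] add_mono snorm_triangle order_refl)
    also have "\<dots> \<le> H * (h * (4 * A + 2 * Q * (2 * R + A))) + (2 * (h * H) * A + 2 * (h * H) * A)"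
      using u h in_I by (intro add_mono x cos_defect) auto
    also have "\<dots> = H * (h * (8 * A + 2 * Q * (2 * R + A)))"
      by (simp add: algebra_simps)
    finally show "snorm K (s - \<alpha>) (\<lambda>j. ?x j - (?p j + ?q j)) \<le> H * (h * (8 * A + 2 * Q * (2 * R + A)))" .
    fix j assume j: "j \<in> idx K"
    have fd: "((\<lambda>\<tau>. flow_vel t h \<tau> j) has_vector_derivative
        cos ((h - \<tau>) * omega j) *\<^sub>R g (t + \<tau>) j) (at \<tau> within {0..h})" if "\<tau> \<in> {0..h}" for \<tau>
      by (rule flow_vel_deriv[OF that _ j]) (use t in auto)
    have p1: "((\<lambda>u. flow_vel t h (h / 2 + 1 * u) j) has_vector_derivative
        1 *\<^sub>R (cos ((h - (h / 2 + 1 * u)) * omega j) *\<^sub>R g (t + (h / 2 + 1 * u)) j)) (at u within {0..h / 2})"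
      by (rule has_vector_derivative_affine[OF fd]) (use u h in auto)
    have p2: "((\<lambda>u. flow_vel t h (h / 2 + (-1) * u) j) has_vector_derivative
        (-1) *\<^sub>R (cos ((h - (h / 2 + (-1) * u)) * omega j) *\<^sub>R g (t + (h / 2 + (-1) * u)) j)) (at u within {0..h / 2})"
      by (rule has_vector_derivative_affine[OF fd]) (use u h in auto)
    have p3: "((\<lambda>u. (2 * u) *\<^sub>R g m j) has_vector_derivative 2 *\<^sub>R g m j) (at u within {0..h / 2})"
      by (auto intro!: derivative_eq_intros)
    have "((\<lambda>u. \<psi> u j) has_vector_derivative
        (1 *\<^sub>R (cos ((h - (h / 2 + 1 * u)) * omega j) *\<^sub>R g (t + (h / 2 + 1 * u)) j)
         - (-1) *\<^sub>R (cos ((h - (h / 2 + (-1) * u)) * omega j) *\<^sub>R g (t + (h / 2 + (-1) * u)) j))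
        - 2 *\<^sub>R g m j) (at u within {0..h / 2})"
      unfolding \<psi>_def
      using has_vector_derivative_diff[OF has_vector_derivative_diff[OF p1 p2] p3] by simp
    moreover have "h - (h / 2 + 1 * u) = h / 2 - u" "h - (h / 2 + (-1) * u) = h / 2 + u"
      "t + (h / 2 + 1 * u) = m + u" "t + (h / 2 + (-1) * u) = m - u"
      by (simp_all add: m_def field_simps)
    ultimately show "((\<lambda>u. \<psi> u j) has_vector_derivative ?x j - (?p j + ?q j)) (at u within {0..h / 2})"
      by (simp only: scaleR_minus_left scaleR_one) (simp add: algebra_simps)
  qed (use h in simp)
  also have "\<dots> \<le> (H * (h * (8 * A + 2 * Q * (2 * R + A)))) * h"
    using h H nonneg R by (intro mult_left_mono) auto
  finally have main: "snorm K (s - \<alpha>) (\<lambda>j. \<psi> (h / 2) j - \<psi> 0 j)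
      \<le> (H * (h * (8 * A + 2 * Q * (2 * R + A)))) * h" .
  have "snorm K (s - \<alpha>) (\<lambda>j. h *\<^sub>R (g m j - F j)) \<le> h * (L * (h\<^sup>2 * A))"
    unfolding snorm_scaleR m_def F_def using t h \<alpha>
    by (simp only: abs_of_pos) (intro mult_left_mono nonlin_mid_error, auto)
  also have "\<dots> \<le> H * (L * (h\<^sup>2 * A))"
    using hH nonneg by (intro mult_right_mono) auto
  finally have mid: "snorm K (s - \<alpha>) (\<lambda>j. h *\<^sub>R (g m j - F j)) \<le> H * (L * (h\<^sup>2 * A))" .
  have "snorm K (s - \<alpha>) (\<lambda>j. (h * (1 - b (h\<^sup>2 * (omega j)\<^sup>2))) *\<^sub>R F j) \<le> (h * (c * (h * H))) * snorm K (s + 1) F"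
  proof (rule snorm_multiplier)
    fix j assume "j \<in> idx K"
    from condA_defect(1)[OF cond \<alpha> c h this]
    have "\<bar>1 - b (h\<^sup>2 * (omega j)\<^sup>2)\<bar> \<le> (c * (h * H)) * jap j powr (1 + \<alpha>)"
      unfolding mult_powr_cancel[OF h(1) jap_pos] H_def using h by (simp add: powr_add)
    from mult_left_mono[OF this, of h] h
    show "\<bar>h * (1 - b (h\<^sup>2 * (omega j)\<^sup>2))\<bar> \<le> (h * (c * (h * H))) * jap j powr (s + 1 - (s - \<alpha>))"
      unfolding abs_mult by (simp add: mult.assoc)
  qed (use h c H in simp)
  also have "\<dots> \<le> (h * (c * (h * H))) * A"
    using F_le c H h by (intro mult_left_mono) auto
  finally have weight: "snorm K (s - \<alpha>) (\<lambda>j. (h * (1 - b (h\<^sup>2 * (omega j)\<^sup>2))) *\<^sub>R F j)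
      \<le> (h * (c * (h * H))) * A" .
  have "y' (t + h) j - snd (erkn_step K p h bb b (y t, y' t)) j
      = (\<psi> (h / 2) j - \<psi> 0 j) + (h *\<^sub>R (g m j - F j) + (h * (1 - b (h\<^sup>2 * (omega j)\<^sup>2))) *\<^sub>R F j)" for j
  proof -
    have "\<psi> 0 j = 0" by (simp add: \<psi>_def)
    moreover have "\<psi> (h / 2) j = y' (t + h) j
        - (- ((omega j * sin (h * omega j)) *\<^sub>R y t j) + cos (h * omega j) *\<^sub>R y' t j) - h *\<^sub>R g m j"
      using flow_vel_end[of t h j] by (simp add: \<psi>_def) (simp add: flow_vel_def)
    ultimately show ?thesis
      unfolding erkn_step_eq F_def[symmetric] by (simp add: algebra_simps)
  qed
  then have "snorm K (s - \<alpha>) (\<lambda>j. y' (t + h) j - snd (erkn_step K p h bb b (y t, y' t)) j)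
      = snorm K (s - \<alpha>) (\<lambda>j. (\<psi> (h / 2) j - \<psi> 0 j)
        + (h *\<^sub>R (g m j - F j) + (h * (1 - b (h\<^sup>2 * (omega j)\<^sup>2))) *\<^sub>R F j))" by presburger
  also have "\<dots> \<le> (H * (h * (8 * A + 2 * Q * (2 * R + A)))) * h
      + (H * (L * (h\<^sup>2 * A)) + (h * (c * (h * H))) * A)"
    by (intro order_trans[OF snorm_triangle] add_mono main order_trans[OF snorm_triangle] mid weight)
  also have "\<dots> = (8 * A + 2 * Q * (2 * R + A) + L * A + c * A) * (h\<^sup>2 * H)"
    by (simp add: power2_eq_square algebra_simps)
  finally show ?thesis by (simp add: H_def)
qed

end

section \<open>Stability\<close>

text \<open>
The sum of the two norms is not preserved by the linear flow, but this Euclidean combination is, up to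
the drift of the zero-frequency component.
\<close>

definition energy :: "int \<Rightarrow> real \<Rightarrow> (int \<Rightarrow> complex) \<Rightarrow> (int \<Rightarrow> complex) \<Rightarrow> real" where
  "energy K \<sigma> u u' = sqrt ((snorm K (\<sigma> + 1) u)\<^sup>2 + (snorm K \<sigma> u')\<^sup>2)"

lemma energy_nonneg: "0 \<le> energy K \<sigma> u u'"
  by (simp add: energy_def)

lemma snorm_le_energy:
  "snorm K (\<sigma> + 1) u \<le> energy K \<sigma> u u'" "snorm K \<sigma> u' \<le> energy K \<sigma> u u'"
  by (simp_all add: energy_def real_le_rsqrt)

lemma energy_triangle:
  "energy K \<sigma> (\<lambda>j. u j + v j) (\<lambda>j. u' j + v' j)
    \<le> energy K \<sigma> u u' + (snorm K (\<sigma> + 1) v + snorm K \<sigma> v')"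
proof -
  have "energy K \<sigma> (\<lambda>j. u j + v j) (\<lambda>j. u' j + v' j)
      \<le> sqrt ((snorm K (\<sigma> + 1) u + snorm K (\<sigma> + 1) v)\<^sup>2 + (snorm K \<sigma> u' + snorm K \<sigma> v')\<^sup>2)"
    unfolding energy_def
    by (intro real_sqrt_le_mono add_mono power_mono snorm_triangle snorm_nonneg)
  also have "\<dots> \<le> energy K \<sigma> u u' + sqrt ((snorm K (\<sigma> + 1) v)\<^sup>2 + (snorm K \<sigma> v')\<^sup>2)"
    unfolding energy_def by (rule real_sqrt_sum_squares_triangle_ineq)
  also have "sqrt ((snorm K (\<sigma> + 1) v)\<^sup>2 + (snorm K \<sigma> v')\<^sup>2) \<le> snorm K (\<sigma> + 1) v + snorm K \<sigma> v'"
    by (intro sqrt_sum_squares_le_sum snorm_nonneg)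
  finally show ?thesis by simp
qed

lemma energy_eq:
  "energy K \<sigma> u u' = sqrt (\<Sum>j\<in>idx K. jap j powr (2 * \<sigma>) * ((jap j * cmod (u j))\<^sup>2 + (cmod (u' j))\<^sup>2))"
proof -
  have "jap j powr (2 * (\<sigma> + 1)) = jap j powr (2 * \<sigma>) * (jap j)\<^sup>2" for j
    using jap_pos[of j] by (simp add: distrib_left powr_add)
  then show ?thesis
    unfolding energy_def snorm_def
    by (simp add: sum_nonneg sum.distrib[symmetric] distrib_left power_mult_distrib mult.assoc)
qed

lemma rotation_isometry:
  fixes a b :: complex and C S :: real
  assumes "C\<^sup>2 + S\<^sup>2 = 1"
  shows "(cmod (C *\<^sub>R a + S *\<^sub>R b))\<^sup>2 + (cmod (C *\<^sub>R b - S *\<^sub>R a))\<^sup>2 = (cmod a)\<^sup>2 + (cmod b)\<^sup>2"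
proof -
  have "(cmod (C *\<^sub>R a + S *\<^sub>R b))\<^sup>2 + (cmod (C *\<^sub>R b - S *\<^sub>R a))\<^sup>2
      = (C\<^sup>2 + S\<^sup>2) * ((cmod a)\<^sup>2 + (cmod b)\<^sup>2)"
    unfolding cmod_power2 by (simp add: power2_eq_square algebra_simps)
  then show ?thesis using assms by simp
qed

text \<open>
For \<open>j \<noteq> 0\<close> the propagator rotates the pair of \<open>omega j\<close> times the position and the velocity.  For
\<open>j = 0\<close> it is \<open>(u, u') \<mapsto> (u + h u', u')\<close>, which is the source of the factor \<open>1 + h\<close>.
\<close>

lemma energy_propagator_le:
  assumes h: "0 \<le> h"
  shows "energy K \<sigma> (\<lambda>j. cos (h * omega j) *\<^sub>R u j + cos_integral h (omega j) *\<^sub>R u' j)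
      (\<lambda>j. - ((omega j * sin (h * omega j)) *\<^sub>R u j) + cos (h * omega j) *\<^sub>R u' j)
    \<le> (1 + h) * energy K \<sigma> u u'"
proof -
  have "(jap j * cmod (cos (h * omega j) *\<^sub>R u j + cos_integral h (omega j) *\<^sub>R u' j))\<^sup>2
      + (cmod (- ((omega j * sin (h * omega j)) *\<^sub>R u j) + cos (h * omega j) *\<^sub>R u' j))\<^sup>2
    \<le> (1 + h)\<^sup>2 * ((jap j * cmod (u j))\<^sup>2 + (cmod (u' j))\<^sup>2)" for j
  proof (cases "omega j = 0")
    case True
    define a b where "a = cmod (u j)" and "b = cmod (u' j)"
    have ab: "0 \<le> a" "0 \<le> b" by (auto simp: a_def b_def)
    have "cmod (u j + h *\<^sub>R u' j) \<le> a + h * b"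
      using norm_triangle_ineq[of "u j" "h *\<^sub>R u' j"] h by (simp add: a_def b_def)
    then have "(cmod (u j + h *\<^sub>R u' j))\<^sup>2 \<le> (a + h * b)\<^sup>2"
      by (intro power_mono) auto
    also have "(a + h * b)\<^sup>2 + b\<^sup>2 \<le> (1 + h)\<^sup>2 * (a\<^sup>2 + b\<^sup>2)"
    proof -
      \<comment> \<open>Right-hand side minus left-hand side.\<close>
      have "0 \<le> h * (a - b)\<^sup>2 + h * (a\<^sup>2 + b\<^sup>2) + h\<^sup>2 * a\<^sup>2"
        using h by simp
      then show ?thesis by (simp add: power2_eq_square algebra_simps)
    qed
    finally show ?thesis
      using True by (simp add: jap_eq_1 cos_integral_def a_def b_def)
  next
    case False
    let ?w = "omega j"
    have w: "0 < ?w" using False omega_nonneg[of j] by simp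
    have "?w *\<^sub>R (cos (h * ?w) *\<^sub>R u j + cos_integral h ?w *\<^sub>R u' j)
        = cos (h * ?w) *\<^sub>R (?w *\<^sub>R u j) + sin (h * ?w) *\<^sub>R u' j"
      using False by (simp add: cos_integral_def scaleR_add_right mult.commute)
    then have "?w * cmod (cos (h * ?w) *\<^sub>R u j + cos_integral h ?w *\<^sub>R u' j)
        = cmod (cos (h * ?w) *\<^sub>R (?w *\<^sub>R u j) + sin (h * ?w) *\<^sub>R u' j)"
      using w by (metis abs_of_pos norm_scaleR)
    moreover have "- ((?w * sin (h * ?w)) *\<^sub>R u j) + cos (h * ?w) *\<^sub>R u' j
        = cos (h * ?w) *\<^sub>R u' j - sin (h * ?w) *\<^sub>R (?w *\<^sub>R u j)"
      by (simp add: mult.commute)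
    moreover have "?w * cmod (u j) = cmod (?w *\<^sub>R u j)"
      using w by simp
    ultimately have "(?w * cmod (cos (h * ?w) *\<^sub>R u j + cos_integral h ?w *\<^sub>R u' j))\<^sup>2
        + (cmod (- ((?w * sin (h * ?w)) *\<^sub>R u j) + cos (h * ?w) *\<^sub>R u' j))\<^sup>2
      = (?w * cmod (u j))\<^sup>2 + (cmod (u' j))\<^sup>2"
      by (simp only: rotation_isometry[OF sin_cos_squared_add2])
    moreover have "1 \<le> (1 + h)\<^sup>2" using h by (simp add: one_le_power)
    ultimately show ?thesis
      unfolding jap_eq_omega[OF False] using mult_right_mono[of 1 "(1 + h)\<^sup>2"] by simp
  qed
  then have "energy K \<sigma> (\<lambda>j. cos (h * omega j) *\<^sub>R u j + cos_integral h (omega j) *\<^sub>R u' j)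
      (\<lambda>j. - ((omega j * sin (h * omega j)) *\<^sub>R u j) + cos (h * omega j) *\<^sub>R u' j)
    \<le> sqrt (\<Sum>j\<in>idx K. jap j powr (2 * \<sigma>) * ((1 + h)\<^sup>2 * ((jap j * cmod (u j))\<^sup>2 + (cmod (u' j))\<^sup>2)))"
    unfolding energy_eq by (intro real_sqrt_le_mono sum_mono mult_left_mono) auto
  also have "\<dots> = sqrt ((1 + h)\<^sup>2 * (\<Sum>j\<in>idx K. jap j powr (2 * \<sigma>) * ((jap j * cmod (u j))\<^sup>2 + (cmod (u' j))\<^sup>2)))"
    by (simp add: sum_distrib_left mult.left_commute)
  also have "\<dots> = (1 + h) * energy K \<sigma> u u'"
    unfolding energy_eq using h by (simp add: real_sqrt_mult)
  finally show ?thesis .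
qed

definition stab_const :: "real \<Rightarrow> nat \<Rightarrow> real \<Rightarrow> real \<Rightarrow> real" where
  "stab_const s p R c = 1 + 2 * (1 + 2 * c) * nl_lip s p R"

text \<open>
One step of the method is Lipschitz with constant \<open>1 + O(h)\<close> in the energy norm of order \<open>s - \<alpha>\<close>.  For
\<open>\<alpha> \<ge> 0\<close> the weights are bounded by Condition \<open>A(0)\<close> and the nonlinearity is estimated in the position
norm itself.  For \<open>\<alpha> < 0\<close> this norm has order larger than \<open>s + 1\<close>, where no Lipschitz bound is available:
the nonlinearity is estimated in the norm of order \<open>s + 1\<close>, and Condition \<open>A(\<alpha>)\<close> gains the missing
derivatives at the expense of \<open>h powr \<alpha>\<close>, which the factor \<open>h\<^sup>2\<close> compensates.  The choice
\<open>\<beta> = min \<alpha> 0\<close> and \<open>\<rho> = s + 1 - \<alpha> + \<beta>\<close> unites both cases.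
\<close>

lemma erkn_step_stable:
  assumes K: "1 \<le> K" and p: "1 \<le> p" and s: "0 \<le> s"
    and h: "0 < h" "h \<le> 1" and \<alpha>: "-1 \<le> \<alpha>" "\<alpha> \<le> 1" and c: "1 \<le> c"
    and cond: "condA K h bb b c 0" "condA K h bb b c \<alpha>" "condA_zero bb b c 0" "condA_zero bb b c \<alpha>"
    and mid: "snorm K (s + 1) (erkn_mid h u u') \<le> R" "snorm K (s + 1) (erkn_mid h v v') \<le> R"
  shows "energy K (s - \<alpha>)
      (\<lambda>j. fst (erkn_step K p h bb b (u, u')) j - fst (erkn_step K p h bb b (v, v')) j)
      (\<lambda>j. snd (erkn_step K p h bb b (u, u')) j - snd (erkn_step K p h bb b (v, v')) j)
    \<le> (1 + stab_const s p R c * h) * energy K (s - \<alpha>) (\<lambda>j. u j - v j) (\<lambda>j. u' j - v' j)"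
proof -
  define e where "e j = u j - v j" for j
  define e' where "e' j = u' j - v' j" for j
  define \<beta> where "\<beta> = min \<alpha> 0"
  define \<rho> where "\<rho> = s + 1 - \<alpha> + \<beta>"
  define E where "E = energy K (s - \<alpha>) e e'"
  define \<Delta> where "\<Delta> j = nonlin K p (erkn_mid h u u') j - nonlin K p (erkn_mid h v v') j" for j
  have R: "0 \<le> R" using mid(1) snorm_nonneg order_trans by blast
  have L: "0 \<le> nl_lip s p R" by (rule nl_consts_nonneg[OF R])
  have \<beta>: "-1 \<le> \<beta>" "\<beta> \<le> 1" "\<beta> \<le> 0" "condA K h bb b c \<beta>" "condA_zero bb b c \<beta>"
    using cond \<alpha> by (auto simp: \<beta>_def min_def)
  have \<rho>: "s - 1 \<le> \<rho>" "\<rho> \<le> s + 1" "\<rho> \<le> s + 1 - \<alpha>" "s - \<alpha> \<le> \<rho>"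
    using \<alpha> s by (auto simp: \<rho>_def \<beta>_def)
  have E: "0 \<le> E" by (simp add: E_def energy_nonneg)
  have \<Delta>: "snorm K \<rho> \<Delta> \<le> nl_lip s p R * (2 * E)"
  proof -
    have "erkn_mid h u u' j - erkn_mid h v v' j = erkn_mid h e e' j" for j
      by (simp add: erkn_mid_eq e_def e'_def algebra_simps)
    then have "snorm K \<rho> \<Delta> \<le> nl_lip s p R * snorm K \<rho> (erkn_mid h e e')"
      unfolding \<Delta>_def[abs_def] using snorm_nonlin_lip[OF K p s \<rho>(1,2) mid] by simp
    also have "snorm K \<rho> (erkn_mid h e e') \<le> snorm K (s - \<alpha> + 1) (erkn_mid h e e')"
      using \<rho> by (intro snorm_mono_index) auto
    also have "\<dots> \<le> snorm K (s - \<alpha> + 1) e + snorm K (s - \<alpha>) e'"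
      using h by (intro snorm_erkn_mid_le) auto
    also have "\<dots> \<le> 2 * E"
      using snorm_le_energy[of K "s - \<alpha>" e e'] snorm_le_energy[of K "s - \<alpha>" e' e]
      unfolding E_def by (smt (verit) snorm_le_energy)
    finally show ?thesis using L by (simp add: mult_left_mono)
  qed
  \<comment> \<open>Thus the factors \<open>h\<^sup>2\<close> and \<open>h powr \<beta>\<close> together leave at least one full factor \<open>h\<close>.\<close>
  have hpow: "h powr (1 + \<beta>) \<le> 1"
    using h \<beta> powr_mono'[of 0 "1 + \<beta>" h] by simp
  have pos_weight: "snorm K (s - \<alpha> + 1) (\<lambda>j. (h\<^sup>2 * bb (h\<^sup>2 * (omega j)\<^sup>2)) *\<^sub>R \<Delta> j) \<le> (h * c) * snorm K \<rho> \<Delta>"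
  proof (rule snorm_multiplier)
    fix j assume "j \<in> idx K"
    from condA_defect(2)[OF \<beta>(4,5) cond(3) \<beta>(1,2) c h this \<beta>(3)]
    have "\<bar>bb (h\<^sup>2 * (omega j)\<^sup>2)\<bar> \<le> (c * h powr \<beta>) * jap j powr \<beta>"
      unfolding mult_powr_cancel[OF h(1) jap_pos] .
    then have "h\<^sup>2 * \<bar>bb (h\<^sup>2 * (omega j)\<^sup>2)\<bar> \<le> h\<^sup>2 * ((c * h powr \<beta>) * jap j powr \<beta>)"
      by (intro mult_left_mono) auto
    also have "\<dots> = (h * c * jap j powr \<beta>) * h powr (1 + \<beta>)"
      using h by (simp add: powr_add power2_eq_square)
    also have "\<dots> \<le> (h * c * jap j powr \<beta>) * 1"
      using h c by (intro mult_left_mono hpow) auto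
    finally show "\<bar>h\<^sup>2 * bb (h\<^sup>2 * (omega j)\<^sup>2)\<bar> \<le> h * c * jap j powr (\<rho> - (s - \<alpha> + 1))"
      by (simp add: abs_mult \<rho>_def)
  qed (use h c in simp)
  have vel_weight: "snorm K (s - \<alpha>) (\<lambda>j. (h * b (h\<^sup>2 * (omega j)\<^sup>2)) *\<^sub>R \<Delta> j) \<le> (h * (1 + c)) * snorm K \<rho> \<Delta>"
  proof (rule snorm_multiplier)
    fix j assume "j \<in> idx K"
    from condA_defect(1)[OF \<beta>(4,5) cond(3) \<beta>(1,2) c h this]
    have "\<bar>1 - b (h\<^sup>2 * (omega j)\<^sup>2)\<bar> \<le> (c * h powr (1 + \<beta>)) * jap j powr (1 + \<beta>)"
      unfolding mult_powr_cancel[OF h(1) jap_pos] .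
    also have "\<dots> \<le> (c * 1) * jap j powr (1 + \<beta>)"
      using c by (intro mult_right_mono mult_left_mono hpow) auto
    finally have "\<bar>b (h\<^sup>2 * (omega j)\<^sup>2)\<bar> \<le> 1 + c * jap j powr (1 + \<beta>)" by linarith
    also have "\<dots> \<le> (1 + c) * jap j powr (1 + \<beta>)"
      using ge_one_powr_ge_zero[OF jap_ge_1, of "1 + \<beta>" j] \<beta> by (simp add: distrib_right)
    finally have "h * \<bar>b (h\<^sup>2 * (omega j)\<^sup>2)\<bar> \<le> h * ((1 + c) * jap j powr (1 + \<beta>))"
      using h by (intro mult_left_mono) auto
    moreover have "1 + \<beta> = \<rho> - (s - \<alpha>)" by (simp add: \<rho>_def)
    ultimately show "\<bar>h * b (h\<^sup>2 * (omega j)\<^sup>2)\<bar> \<le> h * (1 + c) * jap j powr (\<rho> - (s - \<alpha>))"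
      using h by (simp add: abs_mult mult.assoc)
  qed (use h c in simp)
  have "energy K (s - \<alpha>)
      (\<lambda>j. fst (erkn_step K p h bb b (u, u')) j - fst (erkn_step K p h bb b (v, v')) j)
      (\<lambda>j. snd (erkn_step K p h bb b (u, u')) j - snd (erkn_step K p h bb b (v, v')) j)
    = energy K (s - \<alpha>)
      (\<lambda>j. (cos (h * omega j) *\<^sub>R e j + cos_integral h (omega j) *\<^sub>R e' j)
        + (h\<^sup>2 * bb (h\<^sup>2 * (omega j)\<^sup>2)) *\<^sub>R \<Delta> j)
      (\<lambda>j. (- ((omega j * sin (h * omega j)) *\<^sub>R e j) + cos (h * omega j) *\<^sub>R e' j)
        + (h * b (h\<^sup>2 * (omega j)\<^sup>2)) *\<^sub>R \<Delta> j)"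
    unfolding erkn_step_eq e_def e'_def \<Delta>_def by (simp add: algebra_simps)
  also have "\<dots> \<le> (1 + h) * E + ((h * c) * snorm K \<rho> \<Delta> + (h * (1 + c)) * snorm K \<rho> \<Delta>)"
    unfolding E_def using h
    by (intro order_trans[OF energy_triangle] add_mono energy_propagator_le pos_weight vel_weight) auto
  also have "\<dots> \<le> (1 + h) * E + ((h * c) * (nl_lip s p R * (2 * E)) + (h * (1 + c)) * (nl_lip s p R * (2 * E)))"
    using h c by (intro add_mono mult_left_mono \<Delta> order_refl) auto
  also have "\<dots> = (1 + stab_const s p R c * h) * E"
    by (simp add: stab_const_def algebra_simps)
  finally show ?thesis unfolding E_def e_def e'_def .
qed

lemma discrete_gronwall:
  fixes e :: "nat \<Rightarrow> real"
  assumes "0 \<le> a" "0 \<le> d" "e 0 \<le> 0"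
    and "\<And>k. k < n \<Longrightarrow> e (Suc k) \<le> (1 + a) * e k + d"
  shows "e n \<le> real n * d * exp (a * real n)"
proof -
  have "m \<le> n \<Longrightarrow> e m \<le> real m * d * exp (a * real m)" for m
  proof (induction m)
    case 0
    then show ?case using assms(3) by simp
  next
    case (Suc m)
    have "e (Suc m) \<le> (1 + a) * e m + d" using assms(4) Suc by simp
    also have "\<dots> \<le> exp a * (real m * d * exp (a * real m)) + d * exp (a * real (Suc m))"
    proof (rule add_mono)
      have "(1 + a) * e m \<le> (1 + a) * (real m * d * exp (a * real m))"
        using Suc assms(1) by (intro mult_left_mono) auto
      also have "\<dots> \<le> exp a * (real m * d * exp (a * real m))"
        using assms exp_ge_add_one_self[of a] by (intro mult_right_mono) auto
      finally show "(1 + a) * e m \<le> exp a * (real m * d * exp (a * real m))" .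
      have "1 \<le> exp (a * real (Suc m))" using assms(1) by simp
      from mult_left_mono[OF this assms(2)] show "d \<le> d * exp (a * real (Suc m))" by simp
    qed
    also have "\<dots> = real (Suc m) * d * exp (a * real (Suc m))"
      by (simp add: algebra_simps exp_add)
    finally show ?case .
  qed
  then show ?thesis by simp
qed

section \<open>Global error\<close>

lemma local_const_nonneg: "0 \<le> R \<Longrightarrow> 0 \<le> c \<Longrightarrow> 0 \<le> local_const s p R c"
  by (simp add: local_const_def nl_consts_nonneg)

lemma stab_const_nonneg: "0 \<le> R \<Longrightarrow> 0 \<le> c \<Longrightarrow> 0 \<le> stab_const s p R c"
  by (simp add: stab_const_def nl_consts_nonneg)

context bounded_solution
begin

text \<open>
The global error after a step is the propagated error plus the local error.  Stability needs both
internal stages in a common ball; for the numerical stage this follows from the closeness of the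
numerical solution to the exact one in the norms for \<open>\<alpha> = 0\<close>, whence the radius \<open>R + 2\<close>.
\<close>

lemma one_step_error:
  assumes t: "t \<in> I" "t + h \<in> I" and h: "0 < h" "h \<le> 1" and \<alpha>: "-1 \<le> \<alpha>" "\<alpha> \<le> 1" and c: "1 \<le> c"
    and cond: "condA K h bb b c 0" "condA K h bb b c \<alpha>" "condA_zero bb b c 0" "condA_zero bb b c \<alpha>"
    and near: "energy K s (\<lambda>j. y t j - v j) (\<lambda>j. y' t j - v' j) \<le> 1"
  shows "energy K (s - \<alpha>) (\<lambda>j. y (t + h) j - fst (erkn_step K p h bb b (v, v')) j)
      (\<lambda>j. y' (t + h) j - snd (erkn_step K p h bb b (v, v')) j)
    \<le> (1 + stab_const s p (R + 2) c * h) * energy K (s - \<alpha>) (\<lambda>j. y t j - v j) (\<lambda>j. y' t j - v' j)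
      + local_const s p R c * (h\<^sup>2 * h powr \<alpha>)"
proof -
  let ?\<Phi> = "erkn_step K p h bb b"
  define e where "e j = y t j - v j" for j
  define e' where "e' j = y' t j - v' j" for j
  have mid: "snorm K (s + 1) (erkn_mid h (y t) (y' t)) \<le> R"
    using t h by (intro erkn_mid_le)
  have "erkn_mid h v v' j = erkn_mid h (y t) (y' t) j - erkn_mid h e e' j" for j
    by (simp add: erkn_mid_eq e_def e'_def algebra_simps)
  then have "snorm K (s + 1) (erkn_mid h v v')
      = snorm K (s + 1) (\<lambda>j. erkn_mid h (y t) (y' t) j - erkn_mid h e e' j)" by presburger
  also have "\<dots> \<le> R + (snorm K (s + 1) e + snorm K s e')"
    using h by (intro order_trans[OF snorm_diff] add_mono mid snorm_erkn_mid_le) auto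
  also have "\<dots> \<le> R + 2"
    using near snorm_le_energy(1)[of K s e e'] snorm_le_energy(2)[of K s e' e]
    unfolding e_def[abs_def] e'_def[abs_def] by linarith
  finally have mid': "snorm K (s + 1) (erkn_mid h v v') \<le> R + 2" .
  have idx: "s - \<alpha> + 1 = s + 1 - \<alpha>" by simp
  have "energy K (s - \<alpha>) (\<lambda>j. y (t + h) j - fst (?\<Phi> (v, v')) j) (\<lambda>j. y' (t + h) j - snd (?\<Phi> (v, v')) j)
    = energy K (s - \<alpha>)
        (\<lambda>j. (fst (?\<Phi> (y t, y' t)) j - fst (?\<Phi> (v, v')) j) + (y (t + h) j - fst (?\<Phi> (y t, y' t)) j))
        (\<lambda>j. (snd (?\<Phi> (y t, y' t)) j - snd (?\<Phi> (v, v')) j) + (y' (t + h) j - snd (?\<Phi> (y t, y' t)) j))"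
    by simp
  also have "\<dots> \<le> energy K (s - \<alpha>) (\<lambda>j. fst (?\<Phi> (y t, y' t)) j - fst (?\<Phi> (v, v')) j)
        (\<lambda>j. snd (?\<Phi> (y t, y' t)) j - snd (?\<Phi> (v, v')) j)
      + (snorm K (s + 1 - \<alpha>) (\<lambda>j. y (t + h) j - fst (?\<Phi> (y t, y' t)) j)
        + snorm K (s - \<alpha>) (\<lambda>j. y' (t + h) j - snd (?\<Phi> (y t, y' t)) j))"
    unfolding idx[symmetric] by (rule energy_triangle)
  also have "\<dots> \<le> (1 + stab_const s p (R + 2) c * h)
        * energy K (s - \<alpha>) (\<lambda>j. y t j - v j) (\<lambda>j. y' t j - v' j)
      + ((2 * A + L * (R + A) + (c + 2) * A) * (h\<^sup>2 * h powr \<alpha>)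
        + (8 * A + 2 * Q * (2 * R + A) + L * A + c * A) * (h\<^sup>2 * h powr \<alpha>))"
    using mid by (intro add_mono erkn_step_stable[OF K p s h \<alpha> c cond _ mid']
        local_error_pos local_error_vel t h \<alpha> c cond) simp
  finally show ?thesis
    unfolding local_const_def distrib_right .
qed

text \<open>
A bootstrap in two rounds.  With \<open>\<alpha> = 0\<close> the recursion gives an error of at most \<open>G * h \<le> 1\<close>, which keeps
alive the closeness on which the recursion depends.  Once it is known for all steps, the recursion may
be run for the given \<open>\<alpha>\<close>.
\<close>

lemma global_error:
  fixes \<alpha> h c :: real and bb b :: "real \<Rightarrow> real" and n :: nat
  defines "v \<equiv> \<lambda>k. fst (erkn K p h bb b (y t0, y' t0) k)"
    and "v' \<equiv> \<lambda>k. snd (erkn K p h bb b (y t0, y' t0) k)"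
    and "G \<equiv> T * local_const s p R c * exp (stab_const s p (R + 2) c * T)"
  assumes h: "0 < h" "h \<le> 1" and \<alpha>: "-1 \<le> \<alpha>" "\<alpha> \<le> 1" and c: "1 \<le> c"
    and cond: "condA K h bb b c 0" "condA K h bb b c \<alpha>" "condA_zero bb b c 0" "condA_zero bb b c \<alpha>"
    and small: "G * h \<le> 1" and n: "real n * h \<le> T"
  shows "energy K (s - \<alpha>) (\<lambda>j. y (t0 + real n * h) j - v n j) (\<lambda>j. y' (t0 + real n * h) j - v' n j)
    \<le> G * h powr (1 + \<alpha>)"
proof -
  define e where "e \<beta> k = energy K (s - \<beta>) (\<lambda>j. y (t0 + real k * h) j - v k j)
    (\<lambda>j. y' (t0 + real k * h) j - v' k j)" for \<beta> k
  define a where "a = stab_const s p (R + 2) c"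
  define D where "D = local_const s p R c"
  have T: "0 \<le> T" using n h by (meson mult_nonneg_nonneg of_nat_0_le_iff order_trans less_imp_le)
  then have R: "0 \<le> R" using R_nonneg[of t0] by simp
  have a: "0 \<le> a" and D: "0 \<le> D"
    using R c by (simp_all add: a_def D_def stab_const_nonneg local_const_nonneg)
  have step: "e \<beta> m \<le> G * h powr (1 + \<beta>)"
    if \<beta>: "-1 \<le> \<beta>" "\<beta> \<le> 1" "condA K h bb b c \<beta>" "condA_zero bb b c \<beta>"
      and m: "m \<le> n" and near: "\<And>k. k < m \<Longrightarrow> e 0 k \<le> 1" for \<beta> m
  proof -
    have mh: "real m * h \<le> T"
      using m n h by (meson mult_right_mono of_nat_mono order_trans less_imp_le)
    have "e \<beta> m \<le> real m * (D * (h\<^sup>2 * h powr \<beta>)) * exp (a * h * real m)"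
    proof (rule discrete_gronwall)
      have "v 0 = y t0" "v' 0 = y' t0" by (simp_all add: v_def v'_def erkn_def)
      then show "e \<beta> 0 \<le> 0" by (simp add: e_def energy_def snorm_def)
      fix k assume k: "k < m"
      have "real (Suc k) * h \<le> real m * h" using k h by (intro mult_right_mono) auto
      then have "t0 + real k * h + h \<in> I" "t0 + real k * h \<in> I"
        using mh h by (auto simp: algebra_simps)
      moreover have "energy K s (\<lambda>j. y (t0 + real k * h) j - v k j) (\<lambda>j. y' (t0 + real k * h) j - v' k j) \<le> 1"
        using near[OF k] by (simp add: e_def)
      ultimately have "energy K (s - \<beta>)
          (\<lambda>j. y (t0 + real k * h + h) j - fst (erkn_step K p h bb b (v k, v' k)) j)
          (\<lambda>j. y' (t0 + real k * h + h) j - snd (erkn_step K p h bb b (v k, v' k)) j)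
        \<le> (1 + a * h) * e \<beta> k + D * (h\<^sup>2 * h powr \<beta>)"
        unfolding a_def D_def e_def using h \<beta> c cond by (intro one_step_error)
      moreover have "erkn_step K p h bb b (v k, v' k) = (v (Suc k), v' (Suc k))"
        by (simp add: v_def v'_def erkn_def)
      moreover have "t0 + real k * h + h = t0 + real (Suc k) * h"
        by (simp add: algebra_simps)
      ultimately show "e \<beta> (Suc k) \<le> (1 + a * h) * e \<beta> k + D * (h\<^sup>2 * h powr \<beta>)"
        by (simp add: e_def)
    qed (use a D h in simp_all)
    also have "\<dots> = (real m * h) * (D * (h * h powr \<beta>)) * exp (a * (real m * h))"
      by (simp add: power2_eq_square mult_ac)
    also have "\<dots> \<le> T * (D * (h * h powr \<beta>)) * exp (a * T)"
      using mh a D h T by (intro mult_mono) (auto intro: mult_left_mono)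
    also have "\<dots> = G * h powr (1 + \<beta>)"
      using h by (simp add: G_def a_def D_def powr_add)
    finally show ?thesis .
  qed
  have "m \<le> n \<Longrightarrow> e 0 m \<le> 1" for m
  proof (induction m rule: less_induct)
    case (less m)
    then have "e 0 m \<le> G * h powr (1 + 0)"
      using cond by (intro step) auto
    then show ?case using h small by simp
  qed
  then have "e \<alpha> n \<le> G * h powr (1 + \<alpha>)"
    using \<alpha> cond by (intro step) auto
  then show ?thesis by (simp add: e_def)
qed

end

theorem theorem3p3:
  fixes p :: nat and c s M T :: real
  assumes "p \<ge> 1" and "c \<ge> 1" and "s \<ge> 0"
  shows "\<exists>C h0 :: real. h0 > 0 \<and>
    (\<forall>(K :: int) (\<alpha> :: real) (bb :: real \<Rightarrow> real) (b :: real \<Rightarrow> real) (t0 :: real)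
      (y :: real \<Rightarrow> int \<Rightarrow> complex) (y' :: real \<Rightarrow> int \<Rightarrow> complex) (h :: real).
       K \<ge> 1 \<longrightarrow> -1 \<le> \<alpha> \<longrightarrow> \<alpha> \<le> 1 \<longrightarrow>
       semidiscrete_solution K p {t0..t0 + T} y y' \<longrightarrow>
       (\<forall>t. 0 \<le> t - t0 \<and> t - t0 \<le> T \<longrightarrow> snorm K (s + 1) (y t) + snorm K s (y' t) \<le> M) \<longrightarrow>
       0 < h \<longrightarrow> h \<le> h0 \<longrightarrow>
       condA K h bb b c 0 \<longrightarrow> condA K h bb b c \<alpha> \<longrightarrow>
       condA_zero bb b c 0 \<longrightarrow> condA_zero bb b c \<alpha> \<longrightarrow>
       (\<forall>n :: nat. real n * h \<le> T \<longrightarrow>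
          (let (yn, yn') = erkn K p h bb b (y t0, y' t0) n; tn = t0 + real n * h in
             snorm K (s + 1 - \<alpha>) (\<lambda>j. y tn j - yn j) + snorm K (s - \<alpha>) (\<lambda>j. y' tn j - yn' j)
               \<le> C * h powr (1 + \<alpha>))))"
proof -
  define G where "G = T * local_const s p M c * exp (stab_const s p (M + 2) c * T)"
  define h0 where "h0 = 1 / (1 + \<bar>G\<bar>)"
  show ?thesis
  proof (rule exI[of _ "2 * G"], rule exI[of _ h0], intro conjI allI impI)
    show "0 < h0" by (simp add: h0_def add_pos_nonneg)
    fix K :: int and \<alpha> :: real and bb b :: "real \<Rightarrow> real" and t0 :: real
      and y y' :: "real \<Rightarrow> int \<Rightarrow> complex" and h :: real and n :: nat
    assume K: "K \<ge> 1" and \<alpha>: "-1 \<le> \<alpha>" "\<alpha> \<le> 1"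
      and sol: "semidiscrete_solution K p {t0..t0 + T} y y'"
      and bound: "\<forall>t. 0 \<le> t - t0 \<and> t - t0 \<le> T \<longrightarrow> snorm K (s + 1) (y t) + snorm K s (y' t) \<le> M"
      and h: "0 < h" "h \<le> h0"
      and cond: "condA K h bb b c 0" "condA K h bb b c \<alpha>" "condA_zero bb b c 0" "condA_zero bb b c \<alpha>"
      and n: "real n * h \<le> T"
    interpret bounded_solution K p s M t0 T y y'
      using assms K sol bound by unfold_locales auto
    have "h0 \<le> 1" "\<bar>G\<bar> * h0 \<le> 1"
      by (simp_all add: h0_def divide_simps)
    moreover have "G * h \<le> \<bar>G\<bar> * h0"
      using h by (intro mult_mono) auto
    ultimately have le: "h \<le> 1" "G * h \<le> 1" using h by linarith+
    obtain yn yn' where num: "erkn K p h bb b (y t0, y' t0) n = (yn, yn')" by fastforce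
    define tn where "tn = t0 + real n * h"
    have "energy K (s - \<alpha>) (\<lambda>j. y tn j - yn j) (\<lambda>j. y' tn j - yn' j) \<le> G * h powr (1 + \<alpha>)"
      using global_error[OF h(1) le(1) \<alpha> assms(2) cond le(2)[unfolded G_def] n] num
      unfolding G_def tn_def by simp
    then have "snorm K (s + 1 - \<alpha>) (\<lambda>j. y tn j - yn j) + snorm K (s - \<alpha>) (\<lambda>j. y' tn j - yn' j)
        \<le> 2 * G * h powr (1 + \<alpha>)"
      using snorm_le_energy(1)[of K "s - \<alpha>" "\<lambda>j. y tn j - yn j" "\<lambda>j. y' tn j - yn' j"]
        snorm_le_energy(2)[of K "s - \<alpha>" "\<lambda>j. y' tn j - yn' j" "\<lambda>j. y tn j - yn j"]
      by (simp add: add_diff_eq diff_add_eq)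
    then show "let (yn, yn') = erkn K p h bb b (y t0, y' t0) n; tn = t0 + real n * h in
        snorm K (s + 1 - \<alpha>) (\<lambda>j. y tn j - yn j) + snorm K (s - \<alpha>) (\<lambda>j. y' tn j - yn' j)
          \<le> 2 * G * h powr (1 + \<alpha>)"
      unfolding num by (simp add: tn_def)
  qed
qed

end
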